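(* There is an uncountable family $\mathcal{F}$ of pairwise nonisomorphic finitely generated LEF groups such that, for $\Gamma_1,\Gamma_2\in\mathcal{F}$, if $\Gamma_1\neq\Gamma_2$ then $\mathcal{L}_{\Gamma_1}\not\approx\mathcal{L}_{\Gamma_2}$.
   Context: $\mathbb{N}=\{1,2,3,\dots\}$. LEF growth. For groups $\Gamma,\Delta$ and $F\subseteq\Gamma$, a local embedding of $F$ into $\Delta$ is an injective map $\phi:F\to\Delta$ such that $\phi(gh)=\phi(g)\phi(h)$ whenever $g,h,gh\in F$. $\Gamma$ is LEF (locally embeddable into finite groups) if every finite subset of $\Gamma$ has a local embedding into some finite group. If $S$ is a finite generating set of the LEF group $\Gamma$ and $B_S(n)$ is the set of elements of word length at most $n$ with respect to $S$, then $\mathcal{L}_\Gamma^S(n)$ is the minimal order of a finite group $Q$ admitting a local embedding $B_S(n)\to Q$. $\mathcal{L}_\Gamma$ denotes $\mathcal{L}_\Gamma^S$ for any finite generating set $S$; its class under $\approx$ does not depend on $S$. Comparison. For nondecreasing functions $F_1,F_2$, write $F_1\preceq F_2$ if there is a constant $C>0$ (which may be taken to be a positive integer) such that $F_1(n)\leq F_2(Cn)$ for all $n\in\mathbb{N}$; write $F_1\approx F_2$ if $F_1\preceq F_2$ and $F_2\preceq F_1$. *)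

theory Defs
  imports "HOL-Library.Countable_Set" "HOL-Algebra.Generated_Groups"
begin

definition local_embedding ::
    "('a, 'm) monoid_scheme \<Rightarrow> ('b, 'n) monoid_scheme \<Rightarrow> 'a set \<Rightarrow> ('a \<Rightarrow> 'b) \<Rightarrow> bool" where
  "local_embedding G Q F \<phi> \<longleftrightarrow>
     \<phi> ` F \<subseteq> carrier Q \<and> inj_on \<phi> F \<and>
     (\<forall>g\<in>F. \<forall>h\<in>F. g \<otimes>\<^bsub>G\<^esub> h \<in> F \<longrightarrow> \<phi> (g \<otimes>\<^bsub>G\<^esub> h) = \<phi> g \<otimes>\<^bsub>Q\<^esub> \<phi> h)"

text \<open>Finite groups are represented with their elements in \<^typ>\<open>nat\<close>; every finite group is
  isomorphic to one of this form, so this loses no generality. The same holds for finitely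
  generated groups, which are countable.\<close>

definition LEF :: "('a, 'm) monoid_scheme \<Rightarrow> bool" where
  "LEF G \<longleftrightarrow>
     (\<forall>F. F \<subseteq> carrier G \<and> finite F \<longrightarrow>
        (\<exists>(Q :: nat monoid) \<phi>. group Q \<and> finite (carrier Q) \<and> local_embedding G Q F \<phi>))"

definition finite_generating_set :: "('a, 'm) monoid_scheme \<Rightarrow> 'a set \<Rightarrow> bool" where
  "finite_generating_set G S \<longleftrightarrow> S \<subseteq> carrier G \<and> finite S \<and> generate G S = carrier G"

definition finitely_generated :: "('a, 'm) monoid_scheme \<Rightarrow> bool" where
  "finitely_generated G \<longleftrightarrow> (\<exists>S. finite_generating_set G S)"

text \<open>Words are in the letters of \<open>S\<close> and their inverses. The length is only meaningful for
  elements of the subgroup generated by \<open>S\<close>.\<close>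

definition word_length :: "('a, 'm) monoid_scheme \<Rightarrow> 'a set \<Rightarrow> 'a \<Rightarrow> nat" where
  "word_length G S g =
     (LEAST k. \<exists>w. length w = k \<and> set w \<subseteq> S \<union> m_inv G ` S \<and> foldr (\<otimes>\<^bsub>G\<^esub>) w \<one>\<^bsub>G\<^esub> = g)"

definition word_ball :: "('a, 'm) monoid_scheme \<Rightarrow> 'a set \<Rightarrow> nat \<Rightarrow> 'a set" where
  "word_ball G S n = {g \<in> carrier G. word_length G S g \<le> n}"

text \<open>The minimum is over a nonempty set when \<open>G\<close> is an LEF group and \<open>S\<close> a finite generating set.\<close>

definition LEF_growth :: "('a, 'm) monoid_scheme \<Rightarrow> 'a set \<Rightarrow> nat \<Rightarrow> nat" where
  "LEF_growth G S n =
     (LEAST k. \<exists>(Q :: nat monoid) \<phi>. group Q \<and> finite (carrier Q) \<and> order Q = k \<and>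
        local_embedding G Q (word_ball G S n) \<phi>)"

definition growth_le :: "(nat \<Rightarrow> nat) \<Rightarrow> (nat \<Rightarrow> nat) \<Rightarrow> bool" where
  "growth_le F\<^sub>1 F\<^sub>2 \<longleftrightarrow> (\<exists>C>0. \<forall>n\<ge>1. F\<^sub>1 n \<le> F\<^sub>2 (C * n))"

definition growth_equiv :: "(nat \<Rightarrow> nat) \<Rightarrow> (nat \<Rightarrow> nat) \<Rightarrow> bool" where
  "growth_equiv F\<^sub>1 F\<^sub>2 \<longleftrightarrow> growth_le F\<^sub>1 F\<^sub>2 \<and> growth_le F\<^sub>2 F\<^sub>1"

end

theory Submission
  imports Defs "HOL-Algebra.Weak_Morphisms" "HOL-Combinatorics.Permutations"
begin

text \<open>
  For a set \<open>X\<close> of indices let \<open>\<Gamma>\<^sub>X\<close> be the subgroup of the product over \<open>i \<in> X\<close> of the groups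
  \<open>Sym(\<int>/m\<^sub>i)\<close> that is generated by the sequence of rotations and the sequence of transpositions
  \<open>(0 k\<^sub>i)\<close>, where \<open>m\<^sub>i = 2 k\<^sub>i + N\<^sub>i\<close> and \<open>N\<^sub>i\<close> is a multiple of all earlier \<open>m\<^sub>j\<close>.

  As long as \<open>k\<^sub>i\<close> is large compared with \<open>n\<close>, words of length \<open>n\<close> cannot tell the \<open>i\<close>-th factor from
  the lamplighter group \<open>\<int>/2 \<wr> \<int>\<close>, which has finite models of order \<open>2\<^bsup>O(n)\<^esup>\<close>. If the \<open>k\<^sub>i\<close> grow fast
  and \<open>i \<notin> X\<close>, then the LEF growth of \<open>\<Gamma>\<^sub>X\<close> at \<open>n \<approx> C k\<^sub>i\<close> is thus only exponential in \<open>n\<close>.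

  If \<open>i \<in> X\<close>, the conjugates of the transposition by powers of the rotation with exponents divisible
  by \<open>N\<^sub>i\<close> form a Coxeter chain of about \<open>2 k\<^sub>i / N\<^sub>i\<close> generators in the factor \<open>i\<close>, while in every other
  factor they commute with each other. So the Coxeter relations hold up to central elements on a ball of
  radius \<open>O(k\<^sub>i)\<close>, and this forces a finite group containing that ball locally to have order at least
  \<open>(2 k\<^sub>i / N\<^sub>i)!\<close>, which exceeds every \<open>2\<^bsup>C k\<^sub>i\<^esup>\<close>. Hence sets \<open>X\<close> with infinite symmetric
  difference give inequivalent growth functions. Applied to two realisations of the same group, this also shows
  that the groups are pairwise nonisomorphic.
\<close>

section \<open>A lower bound from Coxeter relations modulo the centre\<close>

definition commutes :: "('a, 'm) monoid_scheme \<Rightarrow> 'a \<Rightarrow> 'a \<Rightarrow> bool" where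
  "commutes G a b \<longleftrightarrow> a \<otimes>\<^bsub>G\<^esub> b = b \<otimes>\<^bsub>G\<^esub> a"

lemma commutes_sym: "commutes G a b \<Longrightarrow> commutes G b a"
  by (simp add: commutes_def)

context group
begin

lemma commutes_mult:
  assumes "a \<in> carrier G" "b \<in> carrier G" "c \<in> carrier G" "commutes G a b" "commutes G a c"
  shows "commutes G a (b \<otimes> c)"
  using assms unfolding commutes_def by (metis m_assoc)

lemma commutes_conj:
  assumes "a \<in> carrier G" "b \<in> carrier G" "t \<in> carrier G" "t \<otimes> t = \<one>"
    and "commutes G a (t \<otimes> b \<otimes> t)"
  shows "commutes G (t \<otimes> a \<otimes> t) b"
proof -
  have tt: "t \<otimes> (t \<otimes> x) = x" if "x \<in> carrier G" for x
    using assms that by (metis m_assoc l_one)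
  have "(t \<otimes> a \<otimes> t) \<otimes> b = t \<otimes> (a \<otimes> (t \<otimes> b \<otimes> t)) \<otimes> t"
    using assms(1-4) tt by (simp add: m_assoc)
  also have "\<dots> = t \<otimes> ((t \<otimes> b \<otimes> t) \<otimes> a) \<otimes> t"
    using assms(5) by (simp add: commutes_def)
  also have "\<dots> = b \<otimes> (t \<otimes> a \<otimes> t)"
    using assms(1-4) tt by (simp add: m_assoc)
  finally show ?thesis by (simp add: commutes_def)
qed

lemma commutes_conj_iff:
  assumes "a \<in> carrier G" "b \<in> carrier G" "t \<in> carrier G" "t \<otimes> t = \<one>"
  shows "commutes G a (t \<otimes> b \<otimes> t) \<longleftrightarrow> commutes G (t \<otimes> a \<otimes> t) b"
  using commutes_conj[OF assms] commutes_conj[OF assms(2,1,3,4)] commutes_sym by metis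

end

text \<open>The Coxeter relations of the symmetric group, except that the braid relations are only
  required up to central elements. The generators of the subgroup studied below satisfy the braid
  relations in one factor of a product, while in the other factors they commute.\<close>

locale central_braid = group G for G (structure) +
  fixes s :: "nat \<Rightarrow> 'a" and n :: nat
  assumes s_closed: "i < n \<Longrightarrow> s i \<in> carrier G"
    and s_square: "i < n \<Longrightarrow> s i \<otimes> s i = \<one>"
    and s_far: "i + 2 \<le> j \<Longrightarrow> j < n \<Longrightarrow> commutes G (s i) (s j)"
    and s_central: "Suc i < n \<Longrightarrow> j < n \<Longrightarrow>
      commutes G (s j) (s i \<otimes> s (Suc i) \<otimes> s i \<otimes> (s (Suc i) \<otimes> s i \<otimes> s (Suc i)))"
    and s_adjacent: "Suc i < n \<Longrightarrow> \<not> commutes G (s i) (s (Suc i))"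
begin

text \<open>This is \<open>s (r + d) ... s (r + 1)\<close>. Such products are the coset
  representatives in the usual normal form of permutations.\<close>

primrec chain :: "nat \<Rightarrow> nat \<Rightarrow> 'a" where
  "chain r 0 = \<one>"
| "chain r (Suc d) = s (r + Suc d) \<otimes> chain r d"

text \<open>The conjugate of \<open>s r\<close> by \<open>chain r d\<close>. If \<open>s i\<close>
  is the transposition \<open>(i i+1)\<close>, it is the transposition \<open>(r r+d+1)\<close>; the
  lemmas below recover its commutation pattern from the weaker relations.\<close>

primrec refl_elt :: "nat \<Rightarrow> nat \<Rightarrow> 'a" where
  "refl_elt r 0 = s r"
| "refl_elt r (Suc d) = s (r + Suc d) \<otimes> refl_elt r d \<otimes> s (r + Suc d)"

lemma chain_closed: "r + d < n \<Longrightarrow> chain r d \<in> carrier G"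
  by (induction d) (auto intro: s_closed)

lemma refl_elt_closed: "r + d < n \<Longrightarrow> refl_elt r d \<in> carrier G"
  by (induction d) (auto intro: s_closed)

lemma chain_conj: "r + d < n \<Longrightarrow> chain r d \<otimes> s r = refl_elt r d \<otimes> chain r d"
proof (induction d)
  case (Suc d)
  let ?t = "s (r + Suc d)"
  have c: "?t \<in> carrier G" "chain r d \<in> carrier G" "refl_elt r d \<in> carrier G" "s r \<in> carrier G"
    using Suc.prems by (auto intro: s_closed chain_closed refl_elt_closed)
  have sq: "?t \<otimes> (?t \<otimes> x) = x" if "x \<in> carrier G" for x
    using c that s_square[OF Suc.prems] by (metis m_assoc l_one)
  show ?case using Suc c sq by (simp add: m_assoc)
qed (simp add: s_closed)

lemma refl_elt_commutes_above:
  "r + d + 2 \<le> l \<Longrightarrow> l < n \<Longrightarrow> commutes G (s l) (refl_elt r d)"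
proof (induction d)
  case (Suc d)
  then show ?case
    using commutes_sym[OF s_far[of "r + Suc d" l]]
    by (auto intro!: commutes_mult s_closed refl_elt_closed)
qed (use commutes_sym[OF s_far[of r l]] in simp)

lemma chain_commutes_below:
  "r + d < n \<Longrightarrow> l < r \<Longrightarrow> commutes G (s l) (chain r d)"
proof (induction d)
  case (Suc d)
  then show ?case
    using s_far[of l "r + Suc d"] by (auto intro!: commutes_mult s_closed chain_closed)
qed (simp add: commutes_def s_closed)

text \<open>This replaces the braid relation. The two braid words \<open>u\<close> and
  \<open>v\<close> are involutions, so \<open>u = (u v) v\<close> and \<open>v = u (u v)\<close>,
  and \<open>c\<close> commutes with \<open>u v\<close>.\<close>

lemma braid_commutes:
  assumes i: "Suc i < n" and c: "c \<in> carrier G"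
    and z: "commutes G c (s i \<otimes> s (Suc i) \<otimes> s i \<otimes> (s (Suc i) \<otimes> s i \<otimes> s (Suc i)))"
  shows "commutes G (s (Suc i) \<otimes> s i \<otimes> s (Suc i)) c \<longleftrightarrow> commutes G (s i \<otimes> s (Suc i) \<otimes> s i) c"
proof -
  let ?a = "s i" and ?b = "s (Suc i)"
  let ?u = "?a \<otimes> ?b \<otimes> ?a" and ?v = "?b \<otimes> ?a \<otimes> ?b"
  have ab: "?a \<in> carrier G" "?b \<in> carrier G" using i by (auto intro: s_closed)
  have sq: "?a \<otimes> (?a \<otimes> x) = x" "?b \<otimes> (?b \<otimes> x) = x" if "x \<in> carrier G" for x
    using ab that s_square[of i] s_square[of "Suc i"] i by (metis Suc_lessD m_assoc l_one)+
  have sq': "?a \<otimes> ?a = \<one>" "?b \<otimes> ?b = \<one>" using s_square i by auto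
  have uv: "?u \<in> carrier G" "?v \<in> carrier G" using ab by auto
  have "?u \<otimes> ?u = \<one>" "?v \<otimes> ?v = \<one>" using ab sq sq' by (simp_all add: m_assoc)
  then have u: "?u = (?u \<otimes> ?v) \<otimes> ?v" and v: "?v = ?u \<otimes> (?u \<otimes> ?v)"
    using uv by (metis m_assoc r_one) (metis \<open>?u \<otimes> ?u = \<one>\<close> uv m_assoc l_one)
  have "commutes G c ?u" if "commutes G c ?v"
    by (subst u, rule commutes_mult) (use z that c uv in auto)
  moreover have "commutes G c ?v" if "commutes G c ?u"
    by (subst v, rule commutes_mult) (use z that c uv in auto)
  ultimately show ?thesis using commutes_sym by metis
qed

lemma refl_elt_commutes_central:
  assumes "Suc i < n"
  shows "r + d < n \<Longrightarrow> commutes G (refl_elt r d)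
    (s i \<otimes> s (Suc i) \<otimes> s i \<otimes> (s (Suc i) \<otimes> s i \<otimes> s (Suc i)))"
proof (rule commutes_sym, induction d)
  case 0
  then show ?case using commutes_sym[OF s_central[OF assms, of r]] by simp
next
  case (Suc d)
  have "s i \<in> carrier G" "s (Suc i) \<in> carrier G" using assms by (auto intro: s_closed)
  then show ?case
    using Suc commutes_sym[OF s_central[OF assms, of "r + Suc d"]]
    by (auto intro!: commutes_mult s_closed refl_elt_closed)
qed

text \<open>In the step to \<open>Suc d\<close> only \<open>l = r + d\<close> is new. With
  \<open>a\<close>, \<open>b\<close>, \<open>c\<close> as below the reflection is
  \<open>b a c a b\<close>. Moving conjugations across and exchanging \<open>b a b\<close> for
  \<open>a b a\<close> reduces the claim to \<open>b\<close> commuting with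
  \<open>c\<close>.\<close>

lemma refl_elt_commutes_inner:
  "r < l \<Longrightarrow> l < r + d \<Longrightarrow> r + d < n \<Longrightarrow> commutes G (s l) (refl_elt r d)"
proof (induction d)
  case (Suc d)
  show ?case
  proof (cases "l < r + d")
    case True
    then show ?thesis
      using Suc s_far[of l "r + Suc d"]
      by (auto intro!: commutes_mult s_closed refl_elt_closed)
  next
    case False
    then obtain e where d: "d = Suc e"
      using Suc.prems by (cases d) auto
    with False have l: "l = r + Suc e" using Suc.prems by simp
    let ?a = "s l" and ?b = "s (Suc l)" and ?c = "refl_elt r e"
    have n: "Suc l < n" using Suc.prems l d by simp
    have cl: "?a \<in> carrier G" "?b \<in> carrier G" "?c \<in> carrier G"
      using n l by (auto intro: s_closed refl_elt_closed)
    have sq: "?a \<otimes> ?a = \<one>" "?b \<otimes> ?b = \<one>" using s_square n by auto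
    have sq': "?a \<otimes> (?a \<otimes> x) = x" if "x \<in> carrier G" for x
      using cl that sq by (metis m_assoc l_one)
    have b: "commutes G ?b ?c" using n l by (intro refl_elt_commutes_above) auto
    have inner: "?a \<otimes> (?a \<otimes> ?c \<otimes> ?a) \<otimes> ?a = ?c" using cl sq sq' by (simp add: m_assoc)
    have t: "?a \<otimes> ?c \<otimes> ?a = refl_elt r d" using d l by simp
    have "commutes G ?b (?a \<otimes> (?a \<otimes> ?c \<otimes> ?a) \<otimes> ?a)" using b inner by simp
    then have "commutes G (?a \<otimes> ?b \<otimes> ?a) (?a \<otimes> ?c \<otimes> ?a)"
      using commutes_conj_iff[of ?b "?a \<otimes> ?c \<otimes> ?a" ?a] cl sq by simp
    then have "commutes G (?b \<otimes> ?a \<otimes> ?b) (?a \<otimes> ?c \<otimes> ?a)"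
      using braid_commutes[OF n, of "?a \<otimes> ?c \<otimes> ?a"] cl refl_elt_commutes_central[OF n, of r d]
        t d l n by auto
    then have "commutes G ?a (?b \<otimes> (?a \<otimes> ?c \<otimes> ?a) \<otimes> ?b)"
      using commutes_conj_iff[of ?a "?a \<otimes> ?c \<otimes> ?a" ?b] cl sq by simp
    then show ?thesis using d l by simp
  qed
qed simp

text \<open>If \<open>a\<close> commuted with \<open>b c b\<close>, the exchange of
  \<open>b a b\<close> for \<open>a b a\<close> would make \<open>b\<close> commute with
  \<open>a c a = c\<close>, against the induction hypothesis.\<close>

lemma refl_elt_not_commutes:
  "Suc (r + d) < n \<Longrightarrow> \<not> commutes G (s (Suc (r + d))) (refl_elt r d)"
proof (induction d)
  case 0
  then show ?case using s_adjacent[of r] commutes_sym[of G "s (Suc r)" "s r"] by auto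
next
  case (Suc d)
  let ?l = "Suc (r + d)"
  let ?a = "s (Suc ?l)" and ?b = "s ?l" and ?c = "refl_elt r d"
  have n: "Suc ?l < n" using Suc.prems by simp
  have cl: "?a \<in> carrier G" "?b \<in> carrier G" "?c \<in> carrier G"
    using n by (auto intro: s_closed refl_elt_closed)
  have sq: "?a \<otimes> ?a = \<one>" "?b \<otimes> ?b = \<one>" using s_square n by auto
  have a: "commutes G ?a ?c" using n by (intro refl_elt_commutes_above) auto
  show ?case
  proof
    assume "commutes G (s (Suc (r + Suc d))) (refl_elt r (Suc d))"
    then have "commutes G ?a (?b \<otimes> ?c \<otimes> ?b)" by simp
    then have "commutes G (?b \<otimes> ?a \<otimes> ?b) ?c" using commutes_conj_iff cl sq by simp
    then have "commutes G (?a \<otimes> ?b \<otimes> ?a) ?c"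
      using braid_commutes[OF n] cl refl_elt_commutes_central[OF n, of r d] n by auto
    then have "commutes G ?b (?a \<otimes> ?c \<otimes> ?a)" using commutes_conj_iff cl sq by simp
    moreover have "?a \<otimes> ?c \<otimes> ?a = ?c"
      using a cl sq unfolding commutes_def by (metis m_assoc r_one)
    ultimately show False using Suc.IH n by simp
  qed
qed

text \<open>The generator \<open>s (r + d + 1)\<close> separates them: it commutes with the longer
  reflection if \<open>d' > d + 1\<close>, but not with the shorter one. For
  \<open>d' = d + 1\<close> equality would read \<open>c = a c a\<close>, again a
  commutation.\<close>

lemma refl_elt_distinct:
  assumes "d < d'" "r + d' < n"
  shows "refl_elt r d \<noteq> refl_elt r d'"
proof
  assume eq: "refl_elt r d = refl_elt r d'"
  have not: "\<not> commutes G (s (Suc (r + d))) (refl_elt r d)"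
    using assms by (intro refl_elt_not_commutes) auto
  show False
  proof (cases "d' = Suc d")
    case True
    let ?a = "s (Suc (r + d))" and ?c = "refl_elt r d"
    have cl: "?a \<in> carrier G" "?c \<in> carrier G"
      using assms True by (auto intro: s_closed refl_elt_closed)
    have "?a \<otimes> ?a = \<one>" using s_square assms True by auto
    moreover have "?c = ?a \<otimes> ?c \<otimes> ?a" using eq True by simp
    ultimately have "?a \<otimes> ?c = ?c \<otimes> ?a" using cl by (metis l_one m_assoc m_closed)
    then show False using not by (simp add: commutes_def)
  next
    case False
    then have "commutes G (s (Suc (r + d))) (refl_elt r d')"
      using assms by (intro refl_elt_commutes_inner) auto
    then show False using not eq by simp
  qed
qed

text \<open>Descending induction: the set for \<open>r\<close> consists of the products
  \<open>chain r d\<close> times \<open>g\<close> with \<open>g\<close> in the set for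
  \<open>r + 1\<close>. Since \<open>g\<close> commutes with \<open>s r\<close>, the product
  conjugates \<open>s r\<close> to \<open>refl_elt r d\<close>; hence it determines
  \<open>d\<close>, and then \<open>g\<close>.\<close>

lemma exists_fact_many:
  "r \<le> n \<Longrightarrow> \<exists>E \<subseteq> carrier G. finite E \<and> card E = fact (n - r) \<and>
    (\<forall>g\<in>E. \<forall>l<r. commutes G (s l) g)"
proof (induction rule: inc_induct)
  case base
  show ?case by (rule exI[of _ "{\<one>}"]) (auto simp: commutes_def s_closed)
next
  case (step r)
  then obtain E where E: "E \<subseteq> carrier G" "finite E" "card E = fact (n - Suc r)"
    "\<And>g l. g \<in> E \<Longrightarrow> l < Suc r \<Longrightarrow> commutes G (s l) g" by blast
  define f where "f = (\<lambda>(d, g). chain r d \<otimes> g)"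
  let ?P = "{..<n - r} \<times> E"
  have inj: "inj_on f ?P"
  proof (rule inj_onI, clarify)
    fix d g d' g'
    assume d: "d < n - r" "d' < n - r" and g: "g \<in> E" "g' \<in> E" and "f (d, g) = f (d', g')"
    then have eq: "chain r d \<otimes> g = chain r d' \<otimes> g'" by (simp add: f_def)
    have cl: "chain r d \<in> carrier G" "chain r d' \<in> carrier G" "g \<in> carrier G" "g' \<in> carrier G"
      "s r \<in> carrier G" "refl_elt r d \<in> carrier G" "refl_elt r d' \<in> carrier G"
      using d g E step.hyps by (auto intro: chain_closed s_closed refl_elt_closed)
    have *: "chain r e \<otimes> h \<otimes> s r = refl_elt r e \<otimes> (chain r e \<otimes> h)"
      if "e < n - r" "h \<in> E" for e h
    proof -
      have cl': "chain r e \<in> carrier G" "h \<in> carrier G" "refl_elt r e \<in> carrier G"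
        using that E by (auto intro: chain_closed refl_elt_closed)
      have "chain r e \<otimes> h \<otimes> s r = chain r e \<otimes> s r \<otimes> h"
        using E(4)[OF that(2), of r] cl' cl(5) by (simp add: m_assoc commutes_def)
      then show ?thesis using chain_conj[of r e] that cl' by (simp add: m_assoc)
    qed
    have "refl_elt r d \<otimes> (chain r d \<otimes> g) = refl_elt r d' \<otimes> (chain r d \<otimes> g)"
      using *[OF d(1) g(1)] *[OF d(2) g(2)] eq by simp
    then have "refl_elt r d = refl_elt r d'" using cl by simp
    then have "d = d'"
      using refl_elt_distinct[of d d' r] refl_elt_distinct[of d' d r] d
      by (cases d d' rule: linorder_cases) (auto simp: less_diff_conv add.commute)
    moreover from this have "g = g'" using eq cl by simp
    ultimately show "d = d' \<and> g = g'" by simp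
  qed
  show ?case
  proof (intro exI[of _ "f ` ?P"] conjI ballI allI impI)
    show "f ` ?P \<subseteq> carrier G" using E by (auto simp: f_def intro!: chain_closed)
    show "finite (f ` ?P)" using E by simp
    have "n - r = Suc (n - Suc r)" using step.hyps by simp
    then show "card (f ` ?P) = fact (n - r)"
      using card_image[OF inj] E(3) by (simp add: card_cartesian_product)
    show "commutes G (s l) x" if "x \<in> f ` ?P" "l < r" for x l
      using that E by (auto simp: f_def intro!: commutes_mult chain_commutes_below chain_closed s_closed)
  qed
qed

lemma fact_le_order:
  assumes "finite (carrier G)"
  shows "fact n \<le> order G"
proof -
  obtain E where "E \<subseteq> carrier G" "card E = fact n"
    using exists_fact_many[of 0] by auto
  then show ?thesis using card_mono[OF assms, of E] by (simp add: order_def)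
qed

end

section \<open>Rotations, flips and the lamplighter group\<close>

datatype letter = Up | Down | Flip

instance letter :: countable
  by countable_datatype

primrec letter_act :: "(int \<Rightarrow> 'p \<Rightarrow> 'p) \<Rightarrow> ('p \<Rightarrow> 'p) \<Rightarrow> letter \<Rightarrow> 'p \<Rightarrow> 'p" where
  "letter_act sh fl Up = sh 1"
| "letter_act sh fl Down = sh (- 1)"
| "letter_act sh fl Flip = fl"

primrec act :: "(int \<Rightarrow> 'p \<Rightarrow> 'p) \<Rightarrow> ('p \<Rightarrow> 'p) \<Rightarrow> letter list \<Rightarrow> 'p \<Rightarrow> 'p" where
  "act sh fl [] = id"
| "act sh fl (c # w) = letter_act sh fl c \<circ> act sh fl w"

lemma act_append: "act sh fl (v @ w) = act sh fl v \<circ> act sh fl w"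
  by (induction v) auto

primrec letter_disp :: "letter \<Rightarrow> int" where
  "letter_disp Up = 1"
| "letter_disp Down = - 1"
| "letter_disp Flip = 0"

primrec disp :: "letter list \<Rightarrow> int" where
  "disp [] = 0"
| "disp (c # w) = letter_disp c + disp w"

lemma abs_disp_le: "\<bar>disp w\<bar> \<le> int (length w)"
proof (induction w)
  case (Cons c w)
  then show ?case by (cases c) auto
qed simp

text \<open>Two copies of the integers, whose points over 0 the flip exchanges. A word acts by a
  displacement and by switching the second component over finitely many positions, which are the
  lamps.\<close>

definition line_shift :: "int \<Rightarrow> int \<times> bool \<Rightarrow> int \<times> bool" where
  "line_shift j = (\<lambda>(p, e). (p + j, e))"

definition line_flip :: "int \<times> bool \<Rightarrow> int \<times> bool" where
  "line_flip = (\<lambda>(p, e). (p, if p = 0 then \<not> e else e))"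

abbreviation "line_act \<equiv> act line_shift line_flip"

lemma line_act_fst: "fst (line_act w (p, e)) = p + disp w"
proof (induction w)
  case (Cons c w)
  have "fst (letter_act line_shift line_flip c z) = fst z + letter_disp c" for z
    by (cases c; cases z) (simp_all add: line_shift_def line_flip_def)
  with Cons show ?case by simp
qed simp

lemma line_act_eq_disp: "line_act w = line_act w' \<Longrightarrow> disp w = disp w'"
  using line_act_fst[of w 0 False] line_act_fst[of w' 0 False] by simp

locale flip_flow =
  fixes sh :: "int \<Rightarrow> 'p \<Rightarrow> 'p" and fl :: "'p \<Rightarrow> 'p"
  assumes shift_0: "sh 0 z = z"
    and shift_add: "sh a (sh b z) = sh (a + b) z"
    and flip_flip: "fl (fl z) = z"
begin

lemma act_replicate:
  "act sh fl (replicate e Up) = sh (int e)" "act sh fl (replicate e Down) = sh (- int e)"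
  by (induction e) (auto simp: fun_eq_iff shift_0 shift_add algebra_simps)

end

text \<open>Two lines glued by the flip at 0: the system looks, up to distance \<open>B\<close> from the support of
  the flip, like \<^term>\<open>line_act\<close>, whose group is the lamplighter group.\<close>

locale lamp_model = flip_flow sh fl
  for sh :: "int \<Rightarrow> 'p \<Rightarrow> 'p" and fl :: "'p \<Rightarrow> 'p" +
  fixes \<psi> :: "int \<Rightarrow> bool \<Rightarrow> 'p" and B :: int
  assumes psi_shift: "\<psi> (p + j) e = sh j (\<psi> p e)"
    and flip_psi: "fl (\<psi> 0 e) = \<psi> 0 (\<not> e)"
    and flip_other: "z \<noteq> \<psi> 0 True \<Longrightarrow> z \<noteq> \<psi> 0 False \<Longrightarrow> fl z = z"
    and psi_inj: "\<bar>p\<bar> < B \<Longrightarrow> \<bar>p'\<bar> < B \<Longrightarrow> \<psi> p e = \<psi> p' e' \<Longrightarrow> p = p' \<and> e = e'"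
begin

lemma act_psi:
  "\<bar>p\<bar> + int (length w) \<le> B \<Longrightarrow> act sh fl w (\<psi> p e) = case_prod \<psi> (line_act w (p, e))"
proof (induction w)
  case (Cons c w)
  obtain p' e' where q: "line_act w (p, e) = (p', e')" by fastforce
  \<comment> \<open>After the shorter word the point is still in the range where
    \<open>\<psi>\<close> is injective, so the flip moves it only at position 0.\<close>
  have "\<bar>p'\<bar> < B"
    using line_act_fst[of w p e] q abs_disp_le[of w] Cons.prems by auto
  then have "fl (\<psi> p' e') = \<psi> p' e'" if "p' \<noteq> 0"
    using that psi_inj[of p' 0] by (intro flip_other) force+
  then have "letter_act sh fl c (\<psi> p' e')
      = case_prod \<psi> (letter_act line_shift line_flip c (p', e'))"
    using flip_psi psi_shift[of p' 1 e'] psi_shift[of p' "- 1" e']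
    by (cases c) (auto simp: line_shift_def line_flip_def)
  then show ?case using Cons q by simp
qed simp

text \<open>Partial words displace \<open>z\<close> by at most their length, so it never meets the
  support of the flip.\<close>

lemma act_far:
  "(\<And>p e. \<bar>p\<bar> \<le> int (length w) \<Longrightarrow> z \<noteq> \<psi> p e) \<Longrightarrow> act sh fl w z = sh (disp w) z"
proof (induction w)
  case Nil
  then show ?case by (simp add: shift_0)
next
  case (Cons c w)
  have "sh (disp w) z \<noteq> \<psi> 0 e" for e
  proof
    assume "sh (disp w) z = \<psi> 0 e"
    then have "z = \<psi> (- disp w) e"
      using shift_add[of "- disp w" "disp w" z] psi_shift[of 0 "- disp w" e] by (simp add: shift_0)
    then show False using Cons.prems[of "- disp w" e] abs_disp_le[of w] by simp
  qed
  moreover have "act sh fl w z = sh (disp w) z"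
    by (rule Cons.IH) (use Cons.prems in auto)
  ultimately show ?case using flip_other by (cases c) (auto simp: shift_add)
qed

text \<open>Near the flip the chart \<open>\<psi>\<close> carries one action to the other; elsewhere
  only the displacement counts. Points start within \<open>L\<close> and move by at most
  \<open>L\<close>, which is why \<open>B\<close> must exceed \<open>2 * L\<close>.\<close>

lemma act_eq_iff_line_act:
  assumes L: "length w \<le> L" "length w' \<le> L" "2 * int L < B"
  shows "act sh fl w = act sh fl w' \<longleftrightarrow> line_act w = line_act w'"
proof
  assume eq: "line_act w = line_act w'"
  show "act sh fl w = act sh fl w'"
  proof
    fix z
    show "act sh fl w z = act sh fl w' z"
    proof (cases "\<exists>p e. \<bar>p\<bar> \<le> int L \<and> z = \<psi> p e")
      case True
      then show ?thesis using act_psi[of _ w] act_psi[of _ w'] eq L by force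
    next
      case False
      then have far: "z \<noteq> \<psi> p e" if "\<bar>p\<bar> \<le> int L" for p e
        using that by blast
      have "act sh fl w z = sh (disp w) z" "act sh fl w' z = sh (disp w') z"
        using L by (intro act_far far; simp)+
      then show ?thesis using line_act_eq_disp[OF eq] by simp
    qed
  qed
next
  assume eq: "act sh fl w = act sh fl w'"
  \<comment> \<open>The line is its own chart, so \<open>act_far\<close> also settles its points
    beyond distance \<open>L\<close>.\<close>
  interpret line: lamp_model line_shift line_flip Pair "int L + 1"
    by unfold_locales (auto simp: line_shift_def line_flip_def split: if_splits)
  have near: "line_act w (p, e) = line_act w' (p, e)" if "\<bar>p\<bar> \<le> int L" for p e
  proof -
    have "\<psi> (fst (line_act w (p, e))) (snd (line_act w (p, e)))
      = \<psi> (fst (line_act w' (p, e))) (snd (line_act w' (p, e)))"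
      using act_psi[of p w e] act_psi[of p w' e] that L eq by (simp add: case_prod_beta)
    moreover have "\<bar>fst (line_act w (p, e))\<bar> < B" "\<bar>fst (line_act w' (p, e))\<bar> < B"
      using line_act_fst[of w p e] line_act_fst[of w' p e] abs_disp_le[of w] abs_disp_le[of w'] that L
      by auto
    ultimately show ?thesis using psi_inj by (blast intro: prod_eqI)
  qed
  have d: "disp w = disp w'"
    using near[of 0 False] line_act_fst[of w 0 False] line_act_fst[of w' 0 False] by simp
  show "line_act w = line_act w'"
  proof (rule ext, clarify)
    fix p e
    show "line_act w (p, e) = line_act w' (p, e)"
    proof (cases "\<bar>p\<bar> \<le> int L")
      case False
      then have "line_act w (p, e) = line_shift (disp w) (p, e)"
        "line_act w' (p, e) = line_shift (disp w') (p, e)"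
        using L by (intro line.act_far; force)+
      then show ?thesis using d by simp
    qed (rule near)
  qed
qed

end

section \<open>Cycles, finite lamplighter groups and disjoint unions of cycles\<close>

definition cyc_shift :: "int \<Rightarrow> int \<Rightarrow> int \<Rightarrow> int" where
  "cyc_shift m j z = (if 0 \<le> z \<and> z < m then (z + j) mod m else z)"

lemma cyc_shift_0: "cyc_shift m 0 z = z"
  by (simp add: cyc_shift_def)

lemma cyc_shift_add: "cyc_shift m a (cyc_shift m b z) = cyc_shift m (a + b) z"
  by (auto simp: cyc_shift_def mod_simps algebra_simps)

lemma flip_flow_cycle: "flip_flow (cyc_shift m) (transpose 0 k)"
  by unfold_locales (simp_all add: cyc_shift_0 cyc_shift_add)

lemma mod_eq_imp_eq:
  fixes a b m :: int
  assumes "a mod m = b mod m" "\<bar>a - b\<bar> < m"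
  shows "a = b"
  using assms by (metis mod_eq_dvd_iff dvd_imp_le_int abs_of_nonneg eq_iff_diff_eq_0 linorder_not_le abs_ge_zero order_less_le_trans order_le_less_trans abs_of_pos)

text \<open>The two lines are windows around 0 and \<open>k\<close> on the cycle. They are disjoint
  because \<open>2 * B \<le> k\<close>, and do not meet around the back because
  \<open>2 * k \<le> m\<close>.\<close>

lemma lamp_model_cycle:
  assumes k: "0 < k" "2 * k \<le> m" "2 * B \<le> k"
  shows "lamp_model (cyc_shift m) (transpose 0 k) (\<lambda>p e. (p + (if e then k else 0)) mod m) B"
proof (intro lamp_model.intro flip_flow_cycle lamp_model_axioms.intro)
  fix p j :: int and e
  show "(p + j + (if e then k else 0)) mod m = cyc_shift m j ((p + (if e then k else 0)) mod m)"
    using k by (simp add: cyc_shift_def mod_simps algebra_simps)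
next
  fix p p' :: int and e e'
  let ?a = "p + (if e then k else 0)" and ?b = "p' + (if e' then k else 0)"
  assume p: "\<bar>p\<bar> < B" "\<bar>p'\<bar> < B" and "?a mod m = ?b mod m"
  moreover have "\<bar>?a - ?b\<bar> < m" using p k by (auto split: if_splits)
  ultimately have "?a = ?b" by (rule_tac mod_eq_imp_eq)
  then show "p = p' \<and> e = e'" using p k by (auto split: if_splits)
qed (use k in auto)

definition lamp_shift :: "int \<Rightarrow> int \<Rightarrow> int \<times> bool \<Rightarrow> int \<times> bool" where
  "lamp_shift M j = (\<lambda>(p, e). (cyc_shift M j p, e))"

lemma lamp_model_lamplighter:
  assumes M: "0 < M" "2 * B \<le> M"
  shows "lamp_model (lamp_shift M) line_flip (\<lambda>p e. (p mod M, e)) B"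
proof (unfold_locales, goal_cases)
  case (4 p j e)
  then show ?case using M by (simp add: lamp_shift_def cyc_shift_def mod_simps)
next
  case (7 p p' e e')
  then show ?case using mod_eq_imp_eq[of p M p'] M by auto
qed (auto simp: lamp_shift_def line_flip_def cyc_shift_0 cyc_shift_add split: if_splits)

text \<open>The product over \<open>X\<close> acts on the disjoint union of its cycles. Fibres
  outside \<open>X\<close> are fixed pointwise, so that every \<open>X\<close> gives permutations of
  the same type.\<close>

definition fib_shift :: "(nat \<Rightarrow> int) \<Rightarrow> nat set \<Rightarrow> int \<Rightarrow> nat \<times> int \<Rightarrow> nat \<times> int" where
  "fib_shift m X j = (\<lambda>(i, z). (i, if i \<in> X then cyc_shift (m i) j z else z))"

definition fib_flip :: "(nat \<Rightarrow> int) \<Rightarrow> nat set \<Rightarrow> nat \<times> int \<Rightarrow> nat \<times> int" where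
  "fib_flip k X = (\<lambda>(i, z). (i, if i \<in> X then transpose 0 (k i) z else z))"

lemma flip_flow_fib: "flip_flow (fib_shift m X) (fib_flip k X)"
  by unfold_locales (auto simp: fib_shift_def fib_flip_def cyc_shift_0 cyc_shift_add)

lemma fib_act:
  "act (fib_shift m X) (fib_flip k X) w (i, z) =
    (i, if i \<in> X then act (cyc_shift (m i)) (transpose 0 (k i)) w z else z)"
proof (induction w)
  case (Cons c w)
  then show ?case by (cases c) (auto simp: fib_shift_def fib_flip_def)
qed simp

lemma fib_act_eq_iff:
  "act (fib_shift m X) (fib_flip k X) w = act (fib_shift m X) (fib_flip k X) w' \<longleftrightarrow>
    (\<forall>i\<in>X. act (cyc_shift (m i)) (transpose 0 (k i)) w = act (cyc_shift (m i)) (transpose 0 (k i)) w')"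
  by (auto simp: fun_eq_iff fib_act)

section \<open>Words and marked groups\<close>

abbreviation gprod :: "('a, 'm) monoid_scheme \<Rightarrow> 'a list \<Rightarrow> 'a" where
  "gprod G w \<equiv> foldr (\<otimes>\<^bsub>G\<^esub>) w \<one>\<^bsub>G\<^esub>"

context group
begin

lemma gprod_closed: "set w \<subseteq> carrier G \<Longrightarrow> gprod G w \<in> carrier G"
  by (induction w) auto

lemma gprod_append:
  "set v \<subseteq> carrier G \<Longrightarrow> set w \<subseteq> carrier G \<Longrightarrow> gprod G (v @ w) = gprod G v \<otimes> gprod G w"
proof (induction v)
  case (Cons a v)
  then show ?case
    using gprod_closed[of v] gprod_closed[of w] by (simp add: m_assoc del: foldr_append)
qed (use gprod_closed[of w] in simp)

lemma letters_subset: "S \<subseteq> carrier G \<Longrightarrow> S \<union> m_inv G ` S \<subseteq> carrier G"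
  by auto

lemma exists_word:
  assumes "S \<subseteq> carrier G" "g \<in> generate G S"
  shows "\<exists>w. set w \<subseteq> S \<union> m_inv G ` S \<and> gprod G w = g"
  using assms(2)
proof (induction rule: generate.induct)
  case one
  show ?case by (rule exI[of _ "[]"]) simp
next
  case (incl h)
  then show ?case using assms by (intro exI[of _ "[h]"]) auto
next
  case (inv h)
  then show ?case using assms by (intro exI[of _ "[inv h]"]) auto
next
  case (eng h1 h2)
  then obtain v w where v: "set v \<subseteq> S \<union> m_inv G ` S" "gprod G v = h1"
    and w: "set w \<subseteq> S \<union> m_inv G ` S" "gprod G w = h2" by blast
  have "set v \<subseteq> carrier G" "set w \<subseteq> carrier G"
    using v w letters_subset[OF assms(1)] by blast+
  then have "gprod G (v @ w) = h1 \<otimes> h2" using gprod_append v w by blast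
  then show ?case using v w by (intro exI[of _ "v @ w"]) (simp del: foldr_append)
qed

text \<open>As \<open>S\<close> generates, every element is represented by some word, so the
  \<open>LEAST\<close> in \<open>word_length\<close> is attained.\<close>

lemma word_ball_iff:
  assumes "finite_generating_set G S"
  shows "g \<in> word_ball G S n \<longleftrightarrow>
    (\<exists>w. length w \<le> n \<and> set w \<subseteq> S \<union> m_inv G ` S \<and> gprod G w = g)"
proof -
  have S: "S \<subseteq> carrier G" "generate G S = carrier G"
    using assms by (auto simp: finite_generating_set_def)
  let ?P = "\<lambda>k. \<exists>w. length w = k \<and> set w \<subseteq> S \<union> m_inv G ` S \<and> gprod G w = g"
  show ?thesis
  proof
    assume g: "g \<in> word_ball G S n"
    then obtain w where "set w \<subseteq> S \<union> m_inv G ` S \<and> gprod G w = g"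
      using exists_word[OF S(1)] S(2) by (auto simp: word_ball_def)
    then have "?P (length w)" by blast
    then have "?P (LEAST k. ?P k)" by (rule LeastI)
    moreover have "(LEAST k. ?P k) \<le> n" using g by (simp add: word_ball_def word_length_def)
    ultimately show "\<exists>w. length w \<le> n \<and> set w \<subseteq> S \<union> m_inv G ` S \<and> gprod G w = g" by metis
  next
    assume "\<exists>w. length w \<le> n \<and> set w \<subseteq> S \<union> m_inv G ` S \<and> gprod G w = g"
    then obtain w where w: "length w \<le> n" "set w \<subseteq> S \<union> m_inv G ` S" "gprod G w = g" by blast
    then have "(LEAST k. ?P k) \<le> length w" by (intro Least_le) blast
    moreover have "g \<in> carrier G" using w gprod_closed letters_subset[OF S(1)] by blast
    ultimately show "g \<in> word_ball G S n"
      using w(1) by (simp add: word_ball_def word_length_def)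
  qed
qed

lemma finite_word_ball:
  assumes "finite_generating_set G S"
  shows "finite (word_ball G S n)"
proof -
  have "finite {w. set w \<subseteq> S \<union> m_inv G ` S \<and> length w \<le> n}"
    using assms by (intro finite_lists_length_le) (simp add: finite_generating_set_def)
  moreover have "word_ball G S n \<subseteq> gprod G ` {w. set w \<subseteq> S \<union> m_inv G ` S \<and> length w \<le> n}"
    using word_ball_iff[OF assms] by auto
  ultimately show ?thesis by (rule finite_surj)
qed

lemma word_ball_mono: "m \<le> n \<Longrightarrow> word_ball G S m \<subseteq> word_ball G S n"
  by (auto simp: word_ball_def)

lemma gprod_word_ball:
  assumes "finite_generating_set G S" "set gs \<subseteq> word_ball G S l"
  shows "gprod G gs \<in> word_ball G S (length gs * l)"
  using assms(2)
proof (induction gs)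
  case Nil
  show ?case using word_ball_iff[OF assms(1)] by (auto intro: exI[of _ "[]"])
next
  case (Cons g gs)
  obtain v where v: "length v \<le> l" "set v \<subseteq> S \<union> m_inv G ` S" "gprod G v = g"
    using Cons.prems word_ball_iff[OF assms(1)] by auto
  obtain w where w: "length w \<le> length gs * l" "set w \<subseteq> S \<union> m_inv G ` S" "gprod G w = gprod G gs"
    using Cons word_ball_iff[OF assms(1)] by auto
  have "S \<subseteq> carrier G" using assms by (simp add: finite_generating_set_def)
  then have "set v \<subseteq> carrier G" "set w \<subseteq> carrier G"
    using v w letters_subset by blast+
  then have "gprod G (v @ w) = g \<otimes> gprod G gs" using gprod_append v w by metis
  then show ?case
    unfolding word_ball_iff[OF assms(1)]
    by (intro exI[of _ "v @ w"]) (use v w in \<open>auto simp del: foldr_append\<close>)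
qed

lemma word_ball_subset_scaled:
  assumes S: "finite_generating_set G S" and T: "finite_generating_set G T"
  shows "\<exists>D>0. \<forall>n. word_ball G S n \<subseteq> word_ball G T (D * n)"
proof -
  let ?L = "S \<union> m_inv G ` S"
  have fin: "finite ?L" and sub: "?L \<subseteq> carrier G"
    using S letters_subset by (auto simp: finite_generating_set_def)
  \<comment> \<open>The largest \<open>T\<close>-length of a letter of \<open>S\<close>. The
    inserted 0 covers an empty \<open>S\<close>, and \<open>Suc\<close> makes the factor
    positive.\<close>
  define D where "D = Suc (Max (insert 0 (word_length G T ` ?L)))"
  have L: "?L \<subseteq> word_ball G T D"
  proof
    fix g assume g: "g \<in> ?L"
    then have "word_length G T g \<le> Max (insert 0 (word_length G T ` ?L))"
      using fin by (intro Max_ge) auto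
    then show "g \<in> word_ball G T D" using g sub by (auto simp: word_ball_def D_def)
  qed
  have "word_ball G S n \<subseteq> word_ball G T (D * n)" for n
  proof
    fix g assume "g \<in> word_ball G S n"
    then obtain w where w: "length w \<le> n" "set w \<subseteq> ?L" "gprod G w = g"
      using word_ball_iff[OF S] by auto
    then have "g \<in> word_ball G T (length w * D)" using gprod_word_ball[OF T, of w D] L by auto
    moreover have "length w * D \<le> D * n" using w by simp
    ultimately show "g \<in> word_ball G T (D * n)" using word_ball_mono by blast
  qed
  then show ?thesis by (intro exI[of _ D]) (simp add: D_def)
qed

end

lemma local_embedding_mono:
  "local_embedding G Q F \<phi> \<Longrightarrow> F' \<subseteq> F \<Longrightarrow> local_embedding G Q F' \<phi>"
  unfolding local_embedding_def by (meson image_mono inj_on_subset order_trans subsetD)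

text \<open>All partial products stay in the ball, so the letters split off one at a time. The empty
  product is separate: \<open>\<phi>\<close> sends the identity to an idempotent of
  \<open>Q\<close>, hence to the identity.\<close>

lemma local_embedding_gprod:
  assumes G: "group G" and Q: "group Q" and S: "finite_generating_set G S"
    and \<phi>: "local_embedding G Q (word_ball G S n) \<phi>"
    and gs: "set gs \<subseteq> word_ball G S l" "length gs * l \<le> n"
  shows "\<phi> (gprod G gs) = gprod Q (map \<phi> gs)"
  using gs
proof (induction gs)
  case Nil
  have one: "\<one>\<^bsub>G\<^esub> \<in> word_ball G S n"
    using group.gprod_word_ball[OF G S, of "[]" 0] group.word_ball_mono[OF G, of 0 n S] by auto
  then have "\<phi> (\<one>\<^bsub>G\<^esub> \<otimes>\<^bsub>G\<^esub> \<one>\<^bsub>G\<^esub>) = \<phi> \<one>\<^bsub>G\<^esub> \<otimes>\<^bsub>Q\<^esub> \<phi> \<one>\<^bsub>G\<^esub>"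
    using \<phi> G unfolding local_embedding_def by (metis group.is_monoid monoid.l_one monoid.one_closed)
  moreover have "\<phi> \<one>\<^bsub>G\<^esub> \<in> carrier Q" using one \<phi> by (auto simp: local_embedding_def)
  ultimately show ?case
    using G Q group.l_cancel_one'[OF Q] by (simp add: group.is_monoid)
next
  case (Cons g gs)
  have "g \<in> word_ball G S n"
    using Cons.prems group.word_ball_mono[OF G, of l n S] by auto
  moreover have "gprod G gs \<in> word_ball G S n"
    using Cons.prems group.gprod_word_ball[OF G S, of gs l]
      group.word_ball_mono[OF G, of "length gs * l" n S] by auto
  moreover have "g \<otimes>\<^bsub>G\<^esub> gprod G gs \<in> word_ball G S n"
    using Cons.prems group.gprod_word_ball[OF G S, of "g # gs" l]
      group.word_ball_mono[OF G, of "length (g # gs) * l" n S] by auto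
  ultimately have "\<phi> (g \<otimes>\<^bsub>G\<^esub> gprod G gs) = \<phi> g \<otimes>\<^bsub>Q\<^esub> \<phi> (gprod G gs)"
    using \<phi> by (simp add: local_embedding_def)
  then show ?case using Cons by simp
qed

lemma exists_nat_group_iso:
  fixes H :: "('b, 'm) monoid_scheme"
  assumes "group H" "countable (carrier H)"
  obtains Q :: "nat monoid" and f where "group Q" "f \<in> iso H Q"
proof
  let ?f = "to_nat_on (carrier H)"
  have "inj_on ?f (carrier H)" using assms by auto
  then show "group (image_group ?f H)" "?f \<in> iso H (image_group ?f H)"
    using group.inj_imp_image_group_is_group[OF assms(1)] inj_imp_image_group_iso by blast+
qed

lemma iso_order: "f \<in> iso H Q \<Longrightarrow> order Q = order H"
  unfolding iso_def order_def using bij_betw_same_card by fastforce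

lemma local_embedding_iso:
  assumes "local_embedding G H F \<phi>" "f \<in> iso H Q"
  shows "local_embedding G Q F (f \<circ> \<phi>)"
proof -
  have f: "inj_on f (carrier H)" "f ` carrier H = carrier Q"
    "\<And>a b. a \<in> carrier H \<Longrightarrow> b \<in> carrier H \<Longrightarrow> f (a \<otimes>\<^bsub>H\<^esub> b) = f a \<otimes>\<^bsub>Q\<^esub> f b"
    using assms(2) by (auto simp: iso_def bij_betw_def hom_def)
  have \<phi>: "\<phi> ` F \<subseteq> carrier H" "inj_on \<phi> F" using assms(1) by (auto simp: local_embedding_def)
  have "inj_on (f \<circ> \<phi>) F" using \<phi> f by (auto intro!: comp_inj_on intro: inj_on_subset)
  then show ?thesis
    using assms(1) f \<phi> unfolding local_embedding_def by (auto simp: image_subset_iff)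
qed

section \<open>Groups marked by a rotation and an involution\<close>

primrec letter_elt :: "('a, 'm) monoid_scheme \<Rightarrow> 'a \<Rightarrow> 'a \<Rightarrow> letter \<Rightarrow> 'a" where
  "letter_elt G x y Up = x"
| "letter_elt G x y Down = inv\<^bsub>G\<^esub> x"
| "letter_elt G x y Flip = y"

abbreviation word_elt :: "('a, 'm) monoid_scheme \<Rightarrow> 'a \<Rightarrow> 'a \<Rightarrow> letter list \<Rightarrow> 'a" where
  "word_elt G x y w \<equiv> gprod G (map (letter_elt G x y) w)"

context group
begin

lemma letter_elt_closed: "x \<in> carrier G \<Longrightarrow> y \<in> carrier G \<Longrightarrow> letter_elt G x y c \<in> carrier G"
  by (cases c) auto

lemma word_elt_closed: "x \<in> carrier G \<Longrightarrow> y \<in> carrier G \<Longrightarrow> word_elt G x y w \<in> carrier G"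
  by (auto intro!: gprod_closed letter_elt_closed)

lemma word_elt_append:
  "x \<in> carrier G \<Longrightarrow> y \<in> carrier G \<Longrightarrow>
    word_elt G x y (v @ w) = word_elt G x y v \<otimes> word_elt G x y w"
  using gprod_append[of "map (letter_elt G x y) v" "map (letter_elt G x y) w"] letter_elt_closed
  by (auto simp: image_subset_iff simp del: foldr_append)

end

lemma word_elt_hom:
  assumes "group G" "group H" "f \<in> hom G H" "x \<in> carrier G" "y \<in> carrier G"
  shows "f (word_elt G x y w) = word_elt H (f x) (f y) w"
proof -
  interpret group_hom G H f
    using assms by (simp add: group_hom_def group_hom_axioms_def)
  have l: "f (letter_elt G x y c) = letter_elt H (f x) (f y) c" for c
    using assms by (cases c) auto
  show ?thesis
  proof (induction w)
    case (Cons c w)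
    then show ?case
      using assms(4,5) l G.letter_elt_closed[of x y c] G.word_elt_closed[of x y w] by simp
  qed simp
qed

lemma word_elt_DirProd:
  assumes "group G" "group H" "x \<in> carrier G" "u \<in> carrier H"
  shows "word_elt (G \<times>\<times> H) (x, u) (y, v) w = (word_elt G x y w, word_elt H u v w)"
proof (induction w)
  case (Cons c w)
  then show ?case using assms by (cases c) auto
qed simp

text \<open>\<open>G\<close> is, up to isomorphism, the group of permutations generated by \<^term>\<open>sh 1\<close> and
  \<open>fl\<close>, with \<open>x\<close> and \<open>y\<close> corresponding to the generators.\<close>

definition presents ::
    "('a, 'm) monoid_scheme \<Rightarrow> 'a \<Rightarrow> 'a \<Rightarrow> (int \<Rightarrow> 'p \<Rightarrow> 'p) \<Rightarrow> ('p \<Rightarrow> 'p) \<Rightarrow> bool" where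
  "presents G x y sh fl \<longleftrightarrow> group G \<and> x \<in> carrier G \<and> y \<in> carrier G \<and> y \<otimes>\<^bsub>G\<^esub> y = \<one>\<^bsub>G\<^esub> \<and>
     carrier G = range (word_elt G x y) \<and>
     (\<forall>w w'. word_elt G x y w = word_elt G x y w' \<longleftrightarrow> act sh fl w = act sh fl w')"

lemma presents_iso:
  assumes "presents G x y sh fl" "group H" "f \<in> iso G H"
  shows "presents H (f x) (f y) sh fl"
proof -
  have G: "group G" "x \<in> carrier G" "y \<in> carrier G" "y \<otimes>\<^bsub>G\<^esub> y = \<one>\<^bsub>G\<^esub>"
    "carrier G = range (word_elt G x y)"
    "\<And>w w'. word_elt G x y w = word_elt G x y w' \<longleftrightarrow> act sh fl w = act sh fl w'"
    using assms(1) unfolding presents_def by blast+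
  have f: "inj_on f (carrier G)" "f ` carrier G = carrier H" "f \<in> hom G H"
    using assms(3) by (auto simp: iso_def bij_betw_def)
  have e: "word_elt H (f x) (f y) w = f (word_elt G x y w)" for w
    using word_elt_hom[OF G(1) assms(2) f(3) G(2,3)] by simp
  have "f y \<otimes>\<^bsub>H\<^esub> f y = \<one>\<^bsub>H\<^esub>"
    using f(3) G assms(2) hom_one[OF f(3)] by (metis hom_mult)
  moreover have "carrier H = range (word_elt H (f x) (f y))"
    using f(2) G(5) e by auto
  moreover have "f (word_elt G x y w) = f (word_elt G x y w') \<longleftrightarrow> act sh fl w = act sh fl w'" for w w'
    using G f(1) group.word_elt_closed[OF G(1-3)] by (metis inj_on_eq_iff)
  ultimately show ?thesis
    unfolding presents_def e using assms(2) f(2) G(2,3) by auto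
qed

context flip_flow
begin

definition act_group :: "('p \<Rightarrow> 'p) monoid" where
  "act_group = \<lparr>carrier = range (act sh fl), monoid.mult = (\<circ>), one = id\<rparr>"

lemma shift_inverse: "sh (- 1) \<circ> sh 1 = id" "sh 1 \<circ> sh (- 1) = id"
  by (auto simp: fun_eq_iff shift_add shift_0)

lemma act_inverse: "\<exists>v. act sh fl v \<circ> act sh fl w = id"
proof (induction w)
  case Nil
  show ?case by (rule exI[of _ "[]"]) simp
next
  case (Cons c w)
  then obtain v where v: "act sh fl v \<circ> act sh fl w = id" by blast
  obtain d where d: "letter_act sh fl d \<circ> letter_act sh fl c = id"
  proof (cases c)
    case Up then show ?thesis using that[of Down] shift_inverse by simp
  next
    case Down then show ?thesis using that[of Up] shift_inverse by simp
  next
    case Flip then show ?thesis using that[of Flip] flip_flip by (simp add: fun_eq_iff)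
  qed
  have "act sh fl (v @ [d]) \<circ> act sh fl (c # w)
    = act sh fl v \<circ> (letter_act sh fl d \<circ> letter_act sh fl c) \<circ> act sh fl w"
    by (simp add: act_append comp_assoc)
  then show ?case using v d by (metis comp_id)
qed

lemma act_group: "group act_group"
proof (rule groupI)
  fix f assume "f \<in> carrier act_group"
  then obtain w where "f = act sh fl w" by (auto simp: act_group_def)
  then show "\<exists>g\<in>carrier act_group. g \<otimes>\<^bsub>act_group\<^esub> f = \<one>\<^bsub>act_group\<^esub>"
    using act_inverse[of w] by (auto simp: act_group_def)
qed (auto simp: act_group_def comp_assoc act_append[symmetric] intro: range_eqI[of _ _ "[]"])

lemma presents_act_group: "presents act_group (sh 1) fl sh fl"
proof -
  have cl: "sh 1 \<in> carrier act_group" "fl \<in> carrier act_group"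
    using range_eqI[of "sh 1" "act sh fl" "[Up]"] range_eqI[of fl "act sh fl" "[Flip]"]
    by (auto simp: act_group_def)
  have "sh (- 1) \<in> carrier act_group"
    using range_eqI[of "sh (- 1)" "act sh fl" "[Down]"] by (auto simp: act_group_def)
  then have inv: "inv\<^bsub>act_group\<^esub> sh 1 = sh (- 1)"
    using group.inv_equality[OF act_group] cl shift_inverse by (simp add: act_group_def)
  have l: "letter_elt act_group (sh 1) fl c = letter_act sh fl c" for c
    using inv by (cases c) auto
  have "f \<otimes>\<^bsub>act_group\<^esub> g = f \<circ> g" "\<one>\<^bsub>act_group\<^esub> = id" for f g
    by (simp_all add: act_group_def)
  then have e: "word_elt act_group (sh 1) fl w = act sh fl w" for w
    by (induction w) (simp_all add: l)
  have "fl \<otimes>\<^bsub>act_group\<^esub> fl = \<one>\<^bsub>act_group\<^esub>"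
    by (auto simp: act_group_def flip_flip)
  then show ?thesis
    unfolding presents_def e using act_group cl by (simp add: act_group_def)
qed

lemma exists_nat_presents: "\<exists>(G :: nat monoid) x y. presents G x y sh fl"
proof -
  have "countable (carrier act_group)" by (simp add: act_group_def)
  then show ?thesis
    using exists_nat_group_iso[OF act_group] presents_iso[OF presents_act_group] by metis
qed

end

section \<open>Finite models\<close>

lemma presents_generating:
  assumes "presents G x y sh fl"
  shows "finite_generating_set G {x, y}"
proof -
  have G: "group G" "x \<in> carrier G" "y \<in> carrier G" "carrier G = range (word_elt G x y)"
    using assms unfolding presents_def by blast+
  have "letter_elt G x y c \<in> generate G {x, y}" for c
    by (cases c) (auto intro: generate.intros)
  then have "word_elt G x y w \<in> generate G {x, y}" for w
    by (induction w) (auto intro: generate.intros)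
  then have "carrier G \<subseteq> generate G {x, y}" using G(4) by auto
  moreover have "generate G {x, y} \<subseteq> carrier G"
    using group.generate_in_carrier[OF G(1), of "{x, y}"] G(2,3) by auto
  ultimately show ?thesis using G(2,3) by (auto simp: finite_generating_set_def)
qed

text \<open>Since \<open>y\<close> is its own inverse, the three letters already give all generators
  and their inverses, and lengths do not change.\<close>

lemma presents_word_ball_iff:
  assumes "presents G x y sh fl"
  shows "g \<in> word_ball G {x, y} n \<longleftrightarrow> (\<exists>w. length w \<le> n \<and> word_elt G x y w = g)"
proof -
  have G: "group G" "y \<in> carrier G" "y \<otimes>\<^bsub>G\<^esub> y = \<one>\<^bsub>G\<^esub>"
    using assms unfolding presents_def by blast+
  have y: "inv\<^bsub>G\<^esub> y = y" using group.inv_equality[OF G(1,3,2,2)] .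
  have rng: "{x, y} \<union> m_inv G ` {x, y} = range (letter_elt G x y)"
  proof -
    have *: "(UNIV :: letter set) = {Up, Down, Flip}" using letter.exhaust by auto
    show ?thesis unfolding * by (auto simp: y)
  qed
  show ?thesis
    unfolding group.word_ball_iff[OF G(1) presents_generating[OF assms]] rng
  proof safe
    fix w assume "length w \<le> n" "set w \<subseteq> range (letter_elt G x y)"
    moreover from this obtain v where "w = map (letter_elt G x y) v"
      using ex_map_conv[of w "letter_elt G x y"] by blast
    ultimately show "\<exists>v. length v \<le> n \<and> word_elt G x y v = gprod G w" by auto
  next
    fix w :: "letter list" assume "length w \<le> n"
    then show "\<exists>v. length v \<le> n \<and> set v \<subseteq> range (letter_elt G x y) \<and> gprod G v = word_elt G x y w"
      by (intro exI[of _ "map (letter_elt G x y) w"]) auto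
  qed
qed

text \<open>Choose for each element of the ball a word of length at most \<open>n\<close> and
  evaluate it in \<open>H\<close>. Multiplicativity compares words with concatenations of two such
  words, hence the bound \<open>2 * n\<close>.\<close>

lemma presents_local_embedding:
  assumes G: "presents G x y sh fl" and H: "group H" "u \<in> carrier H" "v \<in> carrier H"
    and agree: "\<And>w w'. length w \<le> 2 * n \<Longrightarrow> length w' \<le> 2 * n \<Longrightarrow>
      act sh fl w = act sh fl w' \<longleftrightarrow> word_elt H u v w = word_elt H u v w'"
  shows "\<exists>\<phi>. local_embedding G H (word_ball G {x, y} n) \<phi>"
proof -
  have G': "group G" "x \<in> carrier G" "y \<in> carrier G"
    "\<And>w w'. word_elt G x y w = word_elt G x y w' \<longleftrightarrow> act sh fl w = act sh fl w'"
    using G unfolding presents_def by blast+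
  define wd where "wd g = (SOME w. length w \<le> n \<and> word_elt G x y w = g)" for g
  have wd: "length (wd g) \<le> n" "word_elt G x y (wd g) = g" if "g \<in> word_ball G {x, y} n" for g
    using someI_ex[of "\<lambda>w. length w \<le> n \<and> word_elt G x y w = g"] that
    unfolding wd_def presents_word_ball_iff[OF G] by blast+
  define \<phi> where "\<phi> g = word_elt H u v (wd g)" for g
  have \<phi>: "\<phi> (word_elt G x y w) = word_elt H u v w"
    if "length w \<le> 2 * n" "word_elt G x y w \<in> word_ball G {x, y} n" for w
  proof -
    let ?v = "wd (word_elt G x y w)"
    have "act sh fl ?v = act sh fl w" using wd(2)[OF that(2)] G'(4) by blast
    then show ?thesis using agree[of ?v w] wd(1)[OF that(2)] that(1) by (simp add: \<phi>_def)
  qed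
  have "local_embedding G H (word_ball G {x, y} n) \<phi>"
    unfolding local_embedding_def
  proof (intro conjI ballI impI inj_onI)
    show "\<phi> ` word_ball G {x, y} n \<subseteq> carrier H"
      using group.word_elt_closed[OF H] by (auto simp: \<phi>_def)
  next
    fix g h assume gh: "g \<in> word_ball G {x, y} n" "h \<in> word_ball G {x, y} n" and "\<phi> g = \<phi> h"
    then have "act sh fl (wd g) = act sh fl (wd h)"
      using agree[of "wd g" "wd h"] wd(1)[OF gh(1)] wd(1)[OF gh(2)] by (simp add: \<phi>_def)
    then show "g = h" using wd(2)[OF gh(1)] wd(2)[OF gh(2)] G'(4) by metis
  next
    fix g h assume gh: "g \<in> word_ball G {x, y} n" "h \<in> word_ball G {x, y} n"
      "g \<otimes>\<^bsub>G\<^esub> h \<in> word_ball G {x, y} n"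
    have e: "word_elt G x y (wd g @ wd h) = g \<otimes>\<^bsub>G\<^esub> h"
      using group.word_elt_append[OF G'(1-3)] wd gh by metis
    have "\<phi> (word_elt G x y (wd g @ wd h)) = word_elt H u v (wd g @ wd h)"
    proof (rule \<phi>)
      show "length (wd g @ wd h) \<le> 2 * n" using wd(1)[OF gh(1)] wd(1)[OF gh(2)] by simp
      show "word_elt G x y (wd g @ wd h) \<in> word_ball G {x, y} n" unfolding e by (rule gh)
    qed
    then show "\<phi> (g \<otimes>\<^bsub>G\<^esub> h) = \<phi> g \<otimes>\<^bsub>H\<^esub> \<phi> h"
      unfolding e using group.word_elt_append[OF H] by (simp add: \<phi>_def)
  qed
  then show ?thesis by blast
qed

text \<open>The normal form in \<open>Z/2 wr Z/M\<close>: a displacement \<open>d\<close> and the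
  set \<open>F\<close> of positions where the second component is switched.\<close>

definition lamp_perm :: "int \<Rightarrow> int \<times> int set \<Rightarrow> int \<times> bool \<Rightarrow> int \<times> bool" where
  "lamp_perm M =
    (\<lambda>(d, F) (p, e). if 0 \<le> p \<and> p < M then ((p + d) mod M, e \<noteq> (p \<in> F)) else (p, e))"

lemma lamplighter_act_range:
  assumes "0 < M"
  shows "act (lamp_shift M) line_flip w \<in> lamp_perm M ` ({0..<M} \<times> Pow {0..<M})"
proof (induction w)
  case Nil
  have "id = lamp_perm M (0, {})" by (auto simp: lamp_perm_def fun_eq_iff)
  moreover have "(0, {}) \<in> {0..<M} \<times> Pow {0..<M}" using assms by simp
  ultimately show ?case unfolding act.simps by (rule image_eqI)
next
  case (Cons c w)
  then obtain d F where dF: "d \<in> {0..<M}" "F \<subseteq> {0..<M}" "act (lamp_shift M) line_flip w = lamp_perm M (d, F)"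
    by auto
  \<comment> \<open>A flip after displacement \<open>d\<close> changes the status of the one
    position that has arrived at 0.\<close>
  have "letter_act (lamp_shift M) line_flip c \<circ> lamp_perm M (d, F) =
      lamp_perm M ((d + letter_disp c) mod M,
        if c = Flip then {p\<in>{0..<M}. (p \<in> F) \<noteq> ((p + d) mod M = 0)} else F)"
    using assms(1) dF(1,2)
    by (cases c) (auto simp: lamp_perm_def fun_eq_iff lamp_shift_def line_flip_def cyc_shift_def mod_simps
        algebra_simps)
  then have "act (lamp_shift M) line_flip (c # w) = lamp_perm M ((d + letter_disp c) mod M,
        if c = Flip then {p\<in>{0..<M}. (p \<in> F) \<noteq> ((p + d) mod M = 0)} else F)"
    using dF(3) by simp
  moreover have "((d + letter_disp c) mod M,
      if c = Flip then {p\<in>{0..<M}. (p \<in> F) \<noteq> ((p + d) mod M = 0)} else F)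
        \<in> {0..<M} \<times> Pow {0..<M}"
    using assms(1) dF(2) by auto
  ultimately show ?case by (rule image_eqI)
qed

lemma lamplighter_act_card:
  assumes "0 < M"
  shows "finite (range (act (lamp_shift (int M)) line_flip))"
    and "card (range (act (lamp_shift (int M)) line_flip)) \<le> M * 2 ^ M"
proof -
  let ?D = "{0..<int M} \<times> Pow {0..<int M}"
  have sub: "range (act (lamp_shift (int M)) line_flip) \<subseteq> lamp_perm (int M) ` ?D"
    using lamplighter_act_range[of "int M"] assms by auto
  have fin: "finite ?D" by simp
  show "finite (range (act (lamp_shift (int M)) line_flip))"
    using sub finite_imageI[OF fin] by (rule finite_subset)
  have "card (range (act (lamp_shift (int M)) line_flip)) \<le> card ?D"
    using surj_card_le[OF fin sub] .
  also have "card ?D = M * 2 ^ M" by (simp add: card_cartesian_product card_Pow)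
  finally show "card (range (act (lamp_shift (int M)) line_flip)) \<le> M * 2 ^ M" .
qed

lemma permutesI_inverse:
  assumes "p \<circ> q = id" "q \<circ> p = id" "\<And>z. z \<notin> A \<Longrightarrow> p z = z"
  shows "p permutes A"
  using assms unfolding permutes_def fun_eq_iff by (metis comp_apply id_apply)

text \<open>Every letter permutes the disjoint union of the cycles before \<open>i\<close> and fixes
  all other points, so the order is at most the factorial of the number of points.\<close>

lemma fib_act_card:
  fixes m k :: "nat \<Rightarrow> int"
  assumes X: "X \<subseteq> {..<i}" and km: "\<And>j. 0 < k j" "\<And>j. k j < m j"
  shows "finite (range (act (fib_shift m X) (fib_flip k X)))"
    and "card (range (act (fib_shift m X) (fib_flip k X))) \<le> fact (\<Sum>j<i. nat (m j))"
proof -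
  interpret flip_flow "fib_shift m X" "fib_flip k X" by (rule flip_flow_fib)
  let ?A = "SIGMA j:{..<i}. {0..<m j}"
  have fin: "finite ?A" by auto
  have sh: "fib_shift m X a (j, z) = (j, z)" if "(j, z) \<notin> ?A" for a j z
    using that X by (auto simp: fib_shift_def cyc_shift_def)
  have fl: "fib_flip k X (j, z) = (j, z)" if "(j, z) \<notin> ?A" for j z
    using that X km[of j] by (auto simp: fib_flip_def transpose_def)
  have off: "fib_shift m X a z = z" "fib_flip k X z = z" if "z \<notin> ?A" for a z
    using that sh fl by (cases z; blast)+
  have "fib_flip k X \<circ> fib_flip k X = id" using flip_flip by (simp add: fun_eq_iff)
  then have l: "letter_act (fib_shift m X) (fib_flip k X) c permutes ?A" for c
    using permutesI_inverse[OF shift_inverse, of ?A] permutesI_inverse[OF shift_inverse(2,1), of ?A]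
      permutesI_inverse[of "fib_flip k X" "fib_flip k X" ?A] off
    by (cases c) auto
  have "act (fib_shift m X) (fib_flip k X) w permutes ?A" for w
  proof (induction w)
    case Nil
    show ?case using permutes_id by (simp add: id_def)
  next
    case (Cons c w)
    then show ?case unfolding act.simps using l by (rule permutes_compose)
  qed
  then have sub: "range (act (fib_shift m X) (fib_flip k X)) \<subseteq> {p. p permutes ?A}" by auto
  show "finite (range (act (fib_shift m X) (fib_flip k X)))"
    using sub finite_permutations[OF fin] by (rule finite_subset)
  have "card (range (act (fib_shift m X) (fib_flip k X))) \<le> card {p. p permutes ?A}"
    using finite_permutations[OF fin] sub by (rule card_mono)
  also have "\<dots> = fact (card ?A)" using card_permutations[OF refl fin] by simp
  also have "card ?A = (\<Sum>j<i. nat (m j))" by simp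
  finally show "card (range (act (fib_shift m X) (fib_flip k X))) \<le> fact (\<Sum>j<i. nat (m j))" .
qed

text \<open>The fibres before \<open>i\<close> are kept, and all later ones are replaced by a single
  group \<open>Z/2 wr Z/M\<close>. Words of length \<open>2 * n\<close> require a chart with
  \<open>B = 4 * n + 1\<close>, and \<open>8 * n + 2 = 2 * B\<close> is the room needed in both
  \<open>M\<close> and \<open>k j\<close>.\<close>

lemma exists_small_local_embedding:
  fixes m k :: "nat \<Rightarrow> int" and n i :: nat
  assumes G: "presents G x y (fib_shift m X) (fib_flip k X)"
    and km: "\<And>j. 0 < k j" "\<And>j. 2 * k j \<le> m j"
    and large: "\<And>j. j \<in> X \<Longrightarrow> i \<le> j \<Longrightarrow> 8 * int n + 2 \<le> k j"
    and ex: "\<exists>j\<in>X. i \<le> j"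
  defines "M \<equiv> 8 * n + 2"
  shows "\<exists>(Q :: nat monoid) \<phi>. group Q \<and> finite (carrier Q) \<and>
    order Q \<le> fact (\<Sum>j<i. nat (m j)) * (M * 2 ^ M) \<and> local_embedding G Q (word_ball G {x, y} n) \<phi>"
proof -
  let ?Y = "X \<inter> {..<i}"
  interpret low: flip_flow "fib_shift m ?Y" "fib_flip k ?Y" by (rule flip_flow_fib)
  interpret lamp: lamp_model "lamp_shift (int M)" line_flip "\<lambda>p e. (p mod int M, e)" "4 * int n + 1"
    by (rule lamp_model_lamplighter) (simp_all add: M_def)
  let ?H = "low.act_group \<times>\<times> lamp.act_group"
  let ?u = "(fib_shift m ?Y 1, lamp_shift (int M) 1)" and ?v = "(fib_flip k ?Y, line_flip)"
  have low: "presents low.act_group (fib_shift m ?Y 1) (fib_flip k ?Y) (fib_shift m ?Y) (fib_flip k ?Y)"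
    by (rule low.presents_act_group)
  have lamp: "presents lamp.act_group (lamp_shift (int M) 1) line_flip (lamp_shift (int M)) line_flip"
    by (rule lamp.presents_act_group)
  have low': "group low.act_group" "fib_shift m ?Y 1 \<in> carrier low.act_group"
    "fib_flip k ?Y \<in> carrier low.act_group"
    using low unfolding presents_def by blast+
  have lamp': "group lamp.act_group" "lamp_shift (int M) 1 \<in> carrier lamp.act_group"
    "line_flip \<in> carrier lamp.act_group"
    using lamp unfolding presents_def by blast+
  have H: "group ?H" "?u \<in> carrier ?H" "?v \<in> carrier ?H"
    using low' lamp' DirProd_group by auto
  have DP: "word_elt ?H ?u ?v w = (word_elt low.act_group (fib_shift m ?Y 1) (fib_flip k ?Y) w,
      word_elt lamp.act_group (lamp_shift (int M) 1) line_flip w)" for w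
    by (rule word_elt_DirProd[OF low'(1) lamp'(1) low'(2) lamp'(2)])
  have low_iff: "word_elt low.act_group (fib_shift m ?Y 1) (fib_flip k ?Y) w =
      word_elt low.act_group (fib_shift m ?Y 1) (fib_flip k ?Y) w' \<longleftrightarrow>
      act (fib_shift m ?Y) (fib_flip k ?Y) w = act (fib_shift m ?Y) (fib_flip k ?Y) w'" for w w'
    using low unfolding presents_def by blast
  have lamp_iff: "word_elt lamp.act_group (lamp_shift (int M) 1) line_flip w =
      word_elt lamp.act_group (lamp_shift (int M) 1) line_flip w' \<longleftrightarrow>
      act (lamp_shift (int M)) line_flip w = act (lamp_shift (int M)) line_flip w'" for w w'
    using lamp unfolding presents_def by blast
  have "\<exists>\<phi>. local_embedding G ?H (word_ball G {x, y} n) \<phi>"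
  proof (rule presents_local_embedding[OF G H])
    fix w w' :: "letter list"
    assume len: "length w \<le> 2 * n" "length w' \<le> 2 * n"
    let ?f = "\<lambda>j. act (cyc_shift (m j)) (transpose 0 (k j))"
    have fib: "?f j w = ?f j w' \<longleftrightarrow> line_act w = line_act w'" if "j \<in> X" "i \<le> j" for j
    proof -
      interpret lamp_model "cyc_shift (m j)" "transpose 0 (k j)"
        "\<lambda>p e. (p + (if e then k j else 0)) mod m j" "4 * int n + 1"
        using km[of j] large[OF that] by (intro lamp_model_cycle) auto
      show ?thesis using act_eq_iff_line_act[OF len] by simp
    qed
    \<comment> \<open>From left to right the line is read off a fibre at or beyond \<open>i\<close>,
      which exists by \<open>ex\<close>.\<close>
    have "act (fib_shift m X) (fib_flip k X) w = act (fib_shift m X) (fib_flip k X) w' \<longleftrightarrow>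
        (\<forall>j\<in>?Y. ?f j w = ?f j w') \<and> line_act w = line_act w'"
      (is "?all \<longleftrightarrow> ?low \<and> ?line")
    proof
      assume ?all
      then show "?low \<and> ?line" unfolding fib_act_eq_iff using fib ex by blast
    next
      assume *: "?low \<and> ?line"
      have "?f j w = ?f j w'" if "j \<in> X" for j
        using * fib[OF that] that by (cases "i \<le> j") auto
      then show ?all unfolding fib_act_eq_iff by blast
    qed
    also have "\<dots> \<longleftrightarrow> act (fib_shift m ?Y) (fib_flip k ?Y) w = act (fib_shift m ?Y) (fib_flip k ?Y) w' \<and>
        act (lamp_shift (int M)) line_flip w = act (lamp_shift (int M)) line_flip w'"
      unfolding fib_act_eq_iff using lamp.act_eq_iff_line_act[OF len] by simp
    also have "\<dots> \<longleftrightarrow> word_elt ?H ?u ?v w = word_elt ?H ?u ?v w'"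
      unfolding DP prod.inject low_iff lamp_iff ..
    finally show "act (fib_shift m X) (fib_flip k X) w = act (fib_shift m X) (fib_flip k X) w' \<longleftrightarrow>
      word_elt ?H ?u ?v w = word_elt ?H ?u ?v w'" .
  qed
  then obtain \<phi> where \<phi>: "local_embedding G ?H (word_ball G {x, y} n) \<phi>" by blast
  have "k j < m j" for j using km[of j] by simp
  then have lowc: "finite (carrier low.act_group)"
    "card (carrier low.act_group) \<le> fact (\<Sum>j<i. nat (m j))"
    using fib_act_card[of ?Y i k m] km by (auto simp: low.act_group_def)
  have lampc: "finite (carrier lamp.act_group)" "card (carrier lamp.act_group) \<le> M * 2 ^ M"
    using lamplighter_act_card[of M] unfolding lamp.act_group_def by (simp_all add: M_def)
  have fin: "finite (carrier ?H)" using lowc lampc by simp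
  have ord: "order ?H \<le> fact (\<Sum>j<i. nat (m j)) * (M * 2 ^ M)"
    using mult_le_mono[OF lowc(2) lampc(2)] by (simp add: order_def card_cartesian_product)
  obtain Q :: "nat monoid" and f where Q: "group Q" "f \<in> iso ?H Q"
    using exists_nat_group_iso[OF H(1) countable_finite[OF fin]] .
  then have "f ` carrier ?H = carrier Q" by (simp add: iso_def bij_betw_def)
  then have "finite (carrier Q)" using finite_imageI[OF fin] by metis
  then show ?thesis
    using Q ord iso_order[OF Q(2)] local_embedding_iso[OF \<phi> Q(2)] by metis
qed

section \<open>The sequence of scales\<close>

text \<open>The total length of the cycles before \<open>i\<close>. The recursion spells out
  \<open>m_seq i\<close> because the other sequences are defined from \<open>scale\<close>.\<close>

primrec scale :: "nat \<Rightarrow> nat" where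
  "scale 0 = 0"
| "scale (Suc i) = scale i + fact (scale i) * (2 * 4 ^ ((fact (scale i))\<^sup>2 + 1) + 1)"

text \<open>The factorial serves twice: every earlier \<open>m_seq j\<close> divides it, and it
  bounds the order contributed by the earlier fibres. Below, \<open>k_seq\<close> and
  \<open>m_seq\<close> are \<open>N_seq\<close> times the coprime numbers \<open>q\<close> and
  \<open>2 * q + 1\<close>, so the multiples of \<open>k_seq i\<close> reach all multiples of
  \<open>N_seq i\<close> modulo \<open>m_seq i\<close>.\<close>

definition N_seq :: "nat \<Rightarrow> nat" where "N_seq i = fact (scale i)"
definition q_seq :: "nat \<Rightarrow> nat" where "q_seq i = 4 ^ ((N_seq i)\<^sup>2 + 1)"
definition k_seq :: "nat \<Rightarrow> nat" where "k_seq i = N_seq i * q_seq i"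
definition m_seq :: "nat \<Rightarrow> nat" where "m_seq i = N_seq i * (2 * q_seq i + 1)"

lemma scale_Suc: "scale (Suc i) = scale i + m_seq i"
  by (simp add: m_seq_def q_seq_def N_seq_def)

lemma scale_eq_sum: "scale i = (\<Sum>j<i. m_seq j)"
proof (induction i)
  case (Suc i)
  then show ?case by (simp add: scale_Suc del: scale.simps)
qed simp

lemma N_seq_pos: "0 < N_seq i" and q_seq_pos: "0 < q_seq i" and k_seq_pos: "0 < k_seq i"
  by (simp_all add: N_seq_def q_seq_def k_seq_def)

lemma N_le_q_seq: "N_seq i \<le> q_seq i"
proof -
  have "N_seq i \<le> (N_seq i)\<^sup>2 + 1" by (simp add: power2_nat_le_imp_le[of "N_seq i"] self_le_power le_SucI N_seq_pos Suc_leI)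
  also have "\<dots> < 2 ^ ((N_seq i)\<^sup>2 + 1)" by (rule less_exp)
  also have "\<dots> \<le> 4 ^ ((N_seq i)\<^sup>2 + 1)" by (rule power_mono) simp_all
  finally show ?thesis by (simp add: q_seq_def)
qed

lemma double_k_le_m_seq: "2 * k_seq i \<le> m_seq i"
  by (simp add: k_seq_def m_seq_def)

lemma m_le_triple_k_seq: "m_seq i \<le> 3 * k_seq i"
  using q_seq_pos[of i] by (simp add: k_seq_def m_seq_def)

lemma mono_scale: "i \<le> j \<Longrightarrow> scale i \<le> scale j"
  by (rule lift_Suc_mono_le[of scale]) (simp_all add: scale_Suc del: scale.simps)

lemma m_le_scale: "i < j \<Longrightarrow> m_seq i \<le> scale j"
  using mono_scale[of "Suc i" j] scale_Suc[of i] by simp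

lemma scale_le_N_seq: "scale i \<le> N_seq i"
  by (simp add: N_seq_def fact_ge_self)

lemma le_N_seq: "i \<le> N_seq i"
proof -
  have "i \<le> scale i"
  proof (induction i)
    case (Suc i)
    then show ?case
      using double_k_le_m_seq[of i] k_seq_pos[of i] by (simp add: scale_Suc del: scale.simps)
  qed simp
  then show ?thesis using scale_le_N_seq le_trans by blast
qed

lemma m_seq_dvd_N_seq: "j < i \<Longrightarrow> m_seq j dvd N_seq i"
  using m_le_scale[of j i] double_k_le_m_seq[of j] k_seq_pos[of j]
  by (simp add: N_seq_def dvd_fact)

lemma N_le_k_seq: "N_seq i \<le> k_seq i"
  using q_seq_pos[of i] by (simp add: k_seq_def)

text \<open>A radius proportional to \<open>k_seq i\<close> stays below all later
  \<open>k_seq j\<close> once the constant is at most \<open>N_seq i\<close>. The bound holds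
  because \<open>m_seq i\<close> is below both factors of \<open>k_seq j\<close>.\<close>

lemma k_seq_growth: "i < j \<Longrightarrow> N_seq i * k_seq i \<le> k_seq j"
proof -
  assume "i < j"
  then have m: "m_seq i \<le> N_seq j" using m_le_scale scale_le_N_seq le_trans by blast
  have "N_seq i * k_seq i \<le> m_seq i * m_seq i"
    using N_le_k_seq[of i] double_k_le_m_seq[of i] by (intro mult_le_mono) auto
  also have "\<dots> \<le> N_seq j * q_seq j"
    using m N_le_q_seq[of j] by (intro mult_le_mono) auto
  finally show ?thesis by (simp add: k_seq_def)
qed

lemma m_le_k_seq: "i < j \<Longrightarrow> m_seq i \<le> k_seq j"
  using m_le_scale[of i j] scale_le_N_seq[of j] N_le_k_seq[of j] by simp

text \<open>Each of the top \<open>q\<close> factors of the factorial exceeds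
  \<open>q\<close>.\<close>

lemma power_le_fact_double: "q ^ q \<le> (fact (2 * q) :: nat)"
proof -
  have "q ^ r \<le> (fact (q + r) :: nat)" for r
  proof (induction r)
    case (Suc r)
    have "q ^ Suc r = q * q ^ r" by simp
    also have "\<dots> \<le> (q + Suc r) * fact (q + r)" using Suc by (intro mult_le_mono) auto
    finally show ?case by simp
  qed simp
  from this[of q] show ?thesis by (simp add: mult_2)
qed

text \<open>By the choice of \<open>q_seq\<close>, \<open>q ^ q\<close> is
  \<open>4 ^ (N^2 * q)\<close> times \<open>4 ^ q\<close>. The first factor absorbs
  \<open>M * 2 ^ M\<close>, the second the factorial \<open>N\<close>.\<close>

lemma seq_gap:
  assumes "M \<le> (N_seq i)\<^sup>2 * q_seq i"
  shows "fact (scale i) * (M * 2 ^ M) < (fact (2 * q_seq i) :: nat)"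
proof -
  let ?N = "N_seq i" and ?q = "q_seq i"
  have "M * 2 ^ M \<le> 2 ^ M * (2 ^ M :: nat)" by (intro mult_le_mono less_imp_le less_exp) simp
  also have "\<dots> = 4 ^ M" by (simp flip: power_mult_distrib)
  also have "\<dots> \<le> 4 ^ (?N\<^sup>2 * ?q)" using assms by (intro power_increasing) auto
  finally have "fact (scale i) * (M * 2 ^ M) \<le> ?N * 4 ^ (?N\<^sup>2 * ?q)"
    by (simp add: N_seq_def)
  also have "\<dots> < 4 ^ ?q * 4 ^ (?N\<^sup>2 * ?q)"
  proof -
    have "?N \<le> ?q" by (rule N_le_q_seq)
    also have "?q < 2 ^ ?q" by (rule less_exp)
    also have "\<dots> \<le> 4 ^ ?q" by (simp add: power_mono)
    finally show ?thesis by simp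
  qed
  also have "\<dots> = ?q ^ ?q"
    by (simp add: q_seq_def flip: power_add power_mult)
  also have "\<dots> \<le> fact (2 * ?q)" by (rule power_le_fact_double)
  finally show ?thesis .
qed

abbreviation "seq_shift \<equiv> fib_shift (\<lambda>i. int (m_seq i))"
abbreviation "seq_flip \<equiv> fib_flip (\<lambda>i. int (k_seq i))"

lemma seq_small_local_embedding:
  assumes "presents G x y (seq_shift X) (seq_flip X)"
    and "\<And>j. j \<in> X \<Longrightarrow> i \<le> j \<Longrightarrow> 8 * n + 2 \<le> k_seq j" and "infinite X"
  shows "\<exists>(Q :: nat monoid) \<phi>. group Q \<and> finite (carrier Q) \<and>
    order Q \<le> fact (scale i) * ((8 * n + 2) * 2 ^ (8 * n + 2)) \<and>
    local_embedding G Q (word_ball G {x, y} n) \<phi>"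
proof -
  have "\<exists>j\<in>X. i \<le> j" using assms(3) by (meson infinite_nat_iff_unbounded_le)
  moreover have "8 * int n + 2 \<le> int (k_seq j)" if "j \<in> X" "i \<le> j" for j
    using assms(2)[OF that] by linarith
  moreover have "0 < int (k_seq j)" "2 * int (k_seq j) \<le> int (m_seq j)" for j
    using k_seq_pos[of j] double_k_le_m_seq[of j] by linarith+
  ultimately show ?thesis
    using exists_small_local_embedding[OF assms(1), of i n] by (simp add: scale_eq_sum)
qed

lemma seq_LEF:
  assumes G: "presents G x y (seq_shift X) (seq_flip X)" and "infinite X"
  shows "LEF G"
  unfolding LEF_def
proof (intro allI impI)
  fix F assume F: "F \<subseteq> carrier G \<and> finite F"
  define n where "n = Max (insert 0 (word_length G {x, y} ` F))"
  have "F \<subseteq> word_ball G {x, y} n"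
    using F by (auto simp: word_ball_def n_def intro!: Max_ge)
  \<comment> \<open>This allows the cutoff index \<open>8 * n + 2\<close> itself, because
    \<open>k_seq j\<close> is at least \<open>j\<close>.\<close>
  moreover have "8 * n + 2 \<le> k_seq j" if "8 * n + 2 \<le> j" for j
    using that le_N_seq[of j] N_le_k_seq[of j] by linarith
  ultimately show "\<exists>(Q :: nat monoid) \<phi>. group Q \<and> finite (carrier Q) \<and> local_embedding G Q F \<phi>"
    using seq_small_local_embedding[OF G, of "8 * n + 2" n] assms(2) local_embedding_mono by metis
qed

section \<open>Conjugates of the transposition by rotations\<close>

definition fprod :: "(nat \<Rightarrow> 'p \<Rightarrow> 'p) \<Rightarrow> nat list \<Rightarrow> 'p \<Rightarrow> 'p" where
  "fprod \<tau> rs = foldr (\<lambda>r f. \<tau> r \<circ> f) rs id"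

lemma fprod_simps [simp]: "fprod \<tau> [] = id" "fprod \<tau> (r # rs) = \<tau> r \<circ> fprod \<tau> rs"
  by (simp_all add: fprod_def)

lemma conj_transpose:
  assumes "\<And>z. f (g z) = z" "\<And>z. g (f z) = z"
  shows "f (transpose a b (g z)) = transpose (f a) (f b) z"
  using assms unfolding transpose_def by metis

definition conj_word :: "nat \<Rightarrow> letter list" where
  "conj_word e = replicate e Up @ [Flip] @ replicate e Down"

lemma cycle_act_conj_word:
  assumes "0 \<le> k" "k < m"
  shows "act (cyc_shift m) (transpose 0 k) (conj_word e) =
    transpose (int e mod m) ((int e + k) mod m)"
proof -
  interpret flip_flow "cyc_shift m" "transpose 0 k" by (rule flip_flow_cycle)
  have "act (cyc_shift m) (transpose 0 k) (conj_word e) z =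
      cyc_shift m (int e) (transpose 0 k (cyc_shift m (- int e) z))" for z
    by (simp add: conj_word_def act_append act_replicate)
  also have "\<dots> z = transpose (cyc_shift m (int e) 0) (cyc_shift m (int e) k) z" for z
    by (rule conj_transpose) (simp_all add: cyc_shift_add cyc_shift_0)
  finally show ?thesis using assms by (simp add: cyc_shift_def fun_eq_iff add.commute)
qed

lemma act_concat: "act sh fl (concat (map w rs)) = fprod (\<lambda>r. act sh fl (w r)) rs"
  by (induction rs) (auto simp: act_append)

text \<open>The product \<open>(a b)(b c)\<close> is a 3-cycle, and its cube is trivial.\<close>

lemma transpose_chain_central:
  assumes "a \<noteq> b" "b \<noteq> c" "a \<noteq> c"
  shows "transpose a b (transpose b c (transpose a b (transpose b c (transpose a b (transpose b c z))))) = z"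
  using assms by (auto simp: transpose_def)

lemma transpose_disjoint_commute:
  assumes "a \<noteq> c" "a \<noteq> d" "b \<noteq> c" "b \<noteq> d"
  shows "transpose a b (transpose c d z) = transpose c d (transpose a b z)"
  using assms by (auto simp: transpose_def)

section \<open>The growth at a scale\<close>

lemma fprod_append: "fprod \<tau> (rs @ rs') = fprod \<tau> rs \<circ> fprod \<tau> rs'"
  by (induction rs) auto

lemma fprod_move:
  assumes "\<And>r. \<tau> j \<circ> \<tau> r = \<tau> r \<circ> \<tau> j"
  shows "fprod \<tau> (j # rs) = fprod \<tau> (rs @ [j])"
proof (induction rs)
  case (Cons r rs)
  have "fprod \<tau> (j # r # rs) = \<tau> r \<circ> fprod \<tau> (j # rs)"
    unfolding fprod_simps using assms[of r] by (metis comp_assoc)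
  then show ?case using Cons by (simp only: fprod_simps append_Cons)
qed simp

text \<open>The exponents are multiples of \<^term>\<open>N_seq i\<close>, so that the conjugates below agree in all
  fibres before \<open>i\<close>; in the fibre \<open>i\<close> they are the transpositions of consecutive points of the
  orbit of 0 under the rotation by \<open>k_seq i\<close>, and in later fibres they have disjoint support.\<close>

definition exponent :: "nat \<Rightarrow> nat \<Rightarrow> nat" where
  "exponent i r = (r * k_seq i) mod m_seq i"

lemma exponent_eq: "exponent i r = N_seq i * ((r * q_seq i) mod (2 * q_seq i + 1))"
  by (simp add: exponent_def k_seq_def m_seq_def mult_mod_right mult.left_commute)

lemma exponent_less: "exponent i r < m_seq i"
  by (simp add: exponent_def m_seq_def N_seq_pos)

text \<open>Modulo \<open>2 * q + 1\<close> the number \<open>q\<close> is invertible, as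
  \<open>2 * q\<close> is congruent to \<open>-1\<close>.\<close>

lemma exponent_inj:
  assumes "r \<le> 2 * q_seq i" "r' \<le> 2 * q_seq i" "exponent i r = exponent i r'"
  shows "r = r'"
proof -
  let ?q = "int (q_seq i)"
  let ?t = "2 * ?q + 1"
  have "(r * q_seq i) mod (2 * q_seq i + 1) = (r' * q_seq i) mod (2 * q_seq i + 1)"
    using assms(3) N_seq_pos[of i] by (simp add: exponent_eq)
  then have "(int r * ?q) mod ?t = (int r' * ?q) mod ?t"
    by (metis (mono_tags, opaque_lifting) of_nat_mult zmod_int of_nat_add of_nat_1 of_nat_numeral)
  then have "?t dvd int r * ?q - int r' * ?q" by (simp add: mod_eq_dvd_iff)
  then have "?t dvd (int r - int r') * ?t - 2 * (int r * ?q - int r' * ?q)"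
    by (rule dvd_diff[OF dvd_triv_right dvd_mult])
  also have "(int r - int r') * ?t - 2 * (int r * ?q - int r' * ?q) = int r - int r'"
    by (simp add: algebra_simps)
  finally have "int r mod ?t = int r' mod ?t" by (simp add: mod_eq_dvd_iff)
  then have "int r = int r'" by (rule mod_eq_imp_eq) (use assms in linarith)
  then show ?thesis by simp
qed

definition fib_transp :: "nat \<Rightarrow> nat \<Rightarrow> nat \<Rightarrow> int \<Rightarrow> int" where
  "fib_transp i j r = transpose (int (exponent i r) mod int (m_seq j))
    ((int (exponent i r) + int (k_seq j)) mod int (m_seq j))"

lemma fib_transp_self:
  "fib_transp i i r = transpose (int (exponent i r)) (int (exponent i (Suc r)))"
proof -
  have "(exponent i r + k_seq i) mod m_seq i = exponent i (Suc r)"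
    by (simp add: exponent_def mod_simps add.commute)
  then show ?thesis
    using exponent_less[of i r]
    by (simp add: fib_transp_def flip: of_nat_add of_nat_mod)
qed

lemma fib_transp_commute:
  assumes "j \<noteq> i"
  shows "fib_transp i j r \<circ> fib_transp i j r' = fib_transp i j r' \<circ> fib_transp i j r"
proof (cases "j < i")
  case True
  \<comment> \<open>\<open>m_seq j\<close> divides \<open>N_seq i\<close>, so all these conjugates
    equal the flip itself.\<close>
  have "int (exponent i r) mod int (m_seq j) = 0" for r
    using m_seq_dvd_N_seq[OF True] by (simp add: exponent_eq flip: of_nat_mod)
  then have "fib_transp i j r = fib_transp i j r'"
    unfolding fib_transp_def by (metis mod_add_left_eq)
  then show ?thesis by simp
next
  case False
  \<comment> \<open>Each transposition now joins a point below \<open>k_seq j\<close> to its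
    translate by \<open>k_seq j\<close>; different exponents give disjoint pairs.\<close>
  then have e: "exponent i r < k_seq j" for r
    using assms m_le_k_seq[of i j] exponent_less[of i r] by linarith
  have t: "fib_transp i j r = transpose (int (exponent i r)) (int (exponent i r) + int (k_seq j))" for r
  proof -
    have "int (exponent i r) + int (k_seq j) < int (m_seq j)"
      using e[of r] double_k_le_m_seq[of j] by linarith
    then show ?thesis by (simp add: fib_transp_def)
  qed
  show ?thesis
  proof (cases "exponent i r = exponent i r'")
    case True
    then show ?thesis by (simp add: t)
  next
    case False
    then show ?thesis
      unfolding t using e[of r] e[of r'] by (auto simp: fun_eq_iff intro!: transpose_disjoint_commute)
  qed
qed

text \<open>The last relation says that the cube of \<open>s l s (l+1)\<close> is central. In fibre
  \<open>i\<close> this cube is trivial; in the others all conjugates commute, although the cube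
  need not vanish there.\<close>

lemma fib_transp_relations:
  fixes i j :: nat
  defines "\<tau> \<equiv> fib_transp i j" and "n \<equiv> 2 * q_seq i"
  shows "fprod \<tau> [r, r] = fprod \<tau> []"
    and "l + 2 \<le> r \<Longrightarrow> r < n \<Longrightarrow> fprod \<tau> [l, r] = fprod \<tau> [r, l]"
    and "Suc l < n \<Longrightarrow>
      fprod \<tau> [r, l, Suc l, l, Suc l, l, Suc l] = fprod \<tau> [l, Suc l, l, Suc l, l, Suc l, r]"
proof -
  show "fprod \<tau> [r, r] = fprod \<tau> []" by (simp add: \<tau>_def fib_transp_def)
next
  assume "l + 2 \<le> r" "r < n"
  show "fprod \<tau> [l, r] = fprod \<tau> [r, l]"
  proof (cases "j = i")
    case True
    have "exponent i a \<noteq> exponent i b" if "a < b" "b \<le> n" for a b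
      using exponent_inj[of a i b] that by (auto simp: n_def)
    then show ?thesis
      using \<open>l + 2 \<le> r\<close> \<open>r < n\<close>
      by (auto simp: \<tau>_def True fib_transp_self fun_eq_iff intro!: transpose_disjoint_commute)
  next
    case False
    then show ?thesis using fib_transp_commute[of j i l r] by (simp add: \<tau>_def)
  qed
next
  assume "Suc l < n"
  show "fprod \<tau> [r, l, Suc l, l, Suc l, l, Suc l] = fprod \<tau> [l, Suc l, l, Suc l, l, Suc l, r]"
  proof (cases "j = i")
    case True
    have "exponent i a \<noteq> exponent i b" if "a < b" "b \<le> n" for a b
      using exponent_inj[of a i b] that by (auto simp: n_def)
    then have "fprod \<tau> [l, Suc l, l, Suc l, l, Suc l] = id"
      using \<open>Suc l < n\<close>
      by (auto simp: \<tau>_def True fib_transp_self fun_eq_iff intro!: transpose_chain_central)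
    then have "fprod \<tau> ([r] @ [l, Suc l, l, Suc l, l, Suc l]) =
        fprod \<tau> ([l, Suc l, l, Suc l, l, Suc l] @ [r])"
      unfolding fprod_append by simp
    then show ?thesis by (simp only: append_Cons append_Nil)
  next
    case False
    then have "\<tau> r \<circ> \<tau> r' = \<tau> r' \<circ> \<tau> r" for r'
      unfolding \<tau>_def by (rule fib_transp_commute)
    then have "fprod \<tau> (r # [l, Suc l, l, Suc l, l, Suc l]) =
        fprod \<tau> ([l, Suc l, l, Suc l, l, Suc l] @ [r])"
      by (rule fprod_move)
    then show ?thesis by (simp only: append_Cons append_Nil)
  qed
qed

lemma fib_transp_adjacent:
  assumes "Suc l < 2 * q_seq i"
  shows "fprod (fib_transp i i) [l, Suc l] \<noteq> fprod (fib_transp i i) [Suc l, l]"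
proof
  let ?e = "\<lambda>r. int (exponent i r)"
  assume "fprod (fib_transp i i) [l, Suc l] = fprod (fib_transp i i) [Suc l, l]"
  \<comment> \<open>At this point the left side gives \<open>?e (l + 1)\<close> and the right side
    \<open>?e (l + 2)\<close>.\<close>
  then have "fprod (fib_transp i i) [l, Suc l] (?e l) = fprod (fib_transp i i) [Suc l, l] (?e l)" by simp
  moreover have "exponent i l \<noteq> exponent i (Suc l)" "exponent i l \<noteq> exponent i (Suc (Suc l))"
    "exponent i (Suc l) \<noteq> exponent i (Suc (Suc l))"
    using exponent_inj[of l i "Suc l"] exponent_inj[of l i "Suc (Suc l)"]
      exponent_inj[of "Suc l" i "Suc (Suc l)"] assms by auto
  ultimately show False by (simp add: fib_transp_self transpose_def split: if_splits)
qed

text \<open>The images in \<open>Q\<close> of the conjugates satisfy \<open>central_braid\<close>.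
  The longest relation has seven factors, which accounts for the radius \<open>7 * l\<close>;
  injectivity of \<open>\<phi>\<close> preserves the failure of neighbours to commute.\<close>

lemma seq_order_ge:
  assumes G: "presents G x y (seq_shift X) (seq_flip X)" and i: "i \<in> X"
    and Q: "group Q" "finite (carrier Q)" and S: "finite_generating_set G S"
    and sub: "word_ball G {x, y} (2 * m_seq i) \<subseteq> word_ball G S l"
    and \<phi>: "local_embedding G Q (word_ball G S (7 * l)) \<phi>"
  shows "fact (2 * q_seq i) \<le> order Q"
proof -
  have G': "group G" "x \<in> carrier G" "y \<in> carrier G"
    "\<And>w w'. word_elt G x y w = word_elt G x y w' \<longleftrightarrow>
      act (seq_shift X) (seq_flip X) w = act (seq_shift X) (seq_flip X) w'"
    using G unfolding presents_def by blast+
  define s where "s r = word_elt G x y (conj_word (exponent i r))" for r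
  have s: "s r \<in> word_ball G S l" for r
  proof -
    have "r * q_seq i mod (2 * q_seq i + 1) \<le> 2 * q_seq i"
      using mod_less_divisor[of "2 * q_seq i + 1" "r * q_seq i"] by linarith
    then have "N_seq i * (r * q_seq i mod (2 * q_seq i + 1)) \<le> N_seq i * (2 * q_seq i)"
      by (rule mult_le_mono2)
    then have "exponent i r + N_seq i \<le> m_seq i"
      by (simp add: exponent_eq m_seq_def)
    then have "length (conj_word (exponent i r)) \<le> 2 * m_seq i"
      using N_seq_pos[of i] by (simp add: conj_word_def)
    then have "s r \<in> word_ball G {x, y} (2 * m_seq i)"
      unfolding presents_word_ball_iff[OF G] s_def
      by (intro exI[of _ "conj_word (exponent i r)"]) simp
    then show ?thesis using sub by blast
  qed
  have sprod: "gprod G (map s rs) = word_elt G x y (concat (map (\<lambda>r. conj_word (exponent i r)) rs))" for rs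
  proof (induction rs)
    case (Cons r rs)
    then show ?case using group.word_elt_append[OF G'(1-3)] by (simp add: s_def)
  qed simp
  have rel: "gprod G (map s rs) = gprod G (map s rs') \<longleftrightarrow>
      (\<forall>j\<in>X. fprod (fib_transp i j) rs = fprod (fib_transp i j) rs')" for rs rs'
  proof -
    have "act (cyc_shift (int (m_seq j))) (transpose 0 (int (k_seq j))) (conj_word (exponent i r))
      = fib_transp i j r" for j r
      unfolding fib_transp_def
      using double_k_le_m_seq[of j] k_seq_pos[of j] by (intro cycle_act_conj_word) auto
    then show ?thesis unfolding sprod G'(4) fib_act_eq_iff by (simp add: act_concat)
  qed
  have hom: "\<phi> (gprod G (map s rs)) = gprod Q (map (\<lambda>r. \<phi> (s r)) rs)" if "length rs \<le> 7" for rs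
  proof -
    have "\<phi> (gprod G (map s rs)) = gprod Q (map \<phi> (map s rs))"
      by (rule local_embedding_gprod[OF G'(1) Q(1) S \<phi>]) (use s that in auto)
    then show ?thesis by (simp add: comp_def)
  qed
  have ball: "gprod G (map s rs) \<in> word_ball G S (7 * l)" if "length rs \<le> 7" for rs
  proof -
    have "gprod G (map s rs) \<in> word_ball G S (length rs * l)"
      using group.gprod_word_ball[OF G'(1) S, of "map s rs" l] s by auto
    moreover have "length rs * l \<le> 7 * l" using that by simp
    ultimately show ?thesis using group.word_ball_mono[OF G'(1)] by blast
  qed
  let ?t = "\<lambda>r. \<phi> (s r)"
  have t: "?t r \<in> carrier Q" for r
    using \<phi> s[of r] group.word_ball_mono[OF G'(1), of l "7 * l" S]
    by (auto simp: local_embedding_def)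
  have eqI: "gprod Q (map ?t rs) = gprod Q (map ?t rs')"
    if "length rs \<le> 7" "length rs' \<le> 7" "\<And>j. fprod (fib_transp i j) rs = fprod (fib_transp i j) rs'" for rs rs'
  proof -
    have "gprod G (map s rs) = gprod G (map s rs')" using rel that(3) by blast
    then show ?thesis
      unfolding hom[OF that(1), symmetric] hom[OF that(2), symmetric] by (rule arg_cong)
  qed
  interpret Q: group Q by (rule Q)
  interpret central_braid Q ?t "2 * q_seq i"
  proof
    fix a b :: nat
    show "?t a \<in> carrier Q" by (rule t)
    show "?t a \<otimes>\<^bsub>Q\<^esub> ?t a = \<one>\<^bsub>Q\<^esub>"
      using eqI[OF _ _ fib_transp_relations(1), of a] t by simp
    show "commutes Q (?t a) (?t b)" if "a + 2 \<le> b" "b < 2 * q_seq i"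
      using eqI[OF _ _ fib_transp_relations(2)[OF that]] t by (simp add: commutes_def)
    show "commutes Q (?t b) (?t a \<otimes>\<^bsub>Q\<^esub> ?t (Suc a) \<otimes>\<^bsub>Q\<^esub> ?t a \<otimes>\<^bsub>Q\<^esub>
        (?t (Suc a) \<otimes>\<^bsub>Q\<^esub> ?t a \<otimes>\<^bsub>Q\<^esub> ?t (Suc a)))" if "Suc a < 2 * q_seq i"
      using eqI[OF _ _ fib_transp_relations(3)[OF that, where r = b]] t
      by (simp add: commutes_def Q.m_assoc)
    show "\<not> commutes Q (?t a) (?t (Suc a))" if a: "Suc a < 2 * q_seq i"
    proof
      assume "commutes Q (?t a) (?t (Suc a))"
      then have eq: "\<phi> (gprod G (map s [a, Suc a])) = \<phi> (gprod G (map s [Suc a, a]))"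
        using hom[of "[a, Suc a]"] hom[of "[Suc a, a]"] t by (simp add: commutes_def)
      have "inj_on \<phi> (word_ball G S (7 * l))" using \<phi> by (simp add: local_embedding_def)
      then have "gprod G (map s [a, Suc a]) = gprod G (map s [Suc a, a])"
        using eq by (rule inj_onD) (rule ball, simp)+
      then show False using rel i fib_transp_adjacent[OF a] by blast
    qed
  qed
  show ?thesis using fact_le_order[OF Q(2)] .
qed

section \<open>Comparison of growth functions\<close>

lemma LEF_growth_attained:
  assumes "group G" "LEF G" "finite_generating_set G S"
  shows "\<exists>(Q :: nat monoid) \<phi>. group Q \<and> finite (carrier Q) \<and> order Q = LEF_growth G S n \<and>
    local_embedding G Q (word_ball G S n) \<phi>"
proof -
  have "word_ball G S n \<subseteq> carrier G" by (auto simp: word_ball_def)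
  then have "\<exists>k (Q :: nat monoid) \<phi>. group Q \<and> finite (carrier Q) \<and> order Q = k \<and>
      local_embedding G Q (word_ball G S n) \<phi>"
    using assms(2) group.finite_word_ball[OF assms(1,3)] unfolding LEF_def by blast
  then show ?thesis unfolding LEF_growth_def by (rule LeastI_ex)
qed

lemma LEF_growth_le:
  fixes Q :: "nat monoid"
  assumes "group Q" "finite (carrier Q)" "local_embedding G Q (word_ball G S n) \<phi>"
  shows "LEF_growth G S n \<le> order Q"
  unfolding LEF_growth_def using assms by (intro Least_le) blast

lemma seq_not_growth_le:
  assumes G1: "presents G\<^sub>1 x\<^sub>1 y\<^sub>1 (seq_shift X) (seq_flip X)"
    and G2: "presents G\<^sub>2 x\<^sub>2 y\<^sub>2 (seq_shift Y) (seq_flip Y)"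
    and inf: "infinite (X - Y)" "infinite Y"
    and S: "finite_generating_set G\<^sub>1 S\<^sub>1" "finite_generating_set G\<^sub>2 S\<^sub>2"
  shows "\<not> growth_le (LEF_growth G\<^sub>1 S\<^sub>1) (LEF_growth G\<^sub>2 S\<^sub>2)"
proof
  assume "growth_le (LEF_growth G\<^sub>1 S\<^sub>1) (LEF_growth G\<^sub>2 S\<^sub>2)"
  then obtain C where C: "C > 0" "\<And>n. n \<ge> 1 \<Longrightarrow> LEF_growth G\<^sub>1 S\<^sub>1 n \<le> LEF_growth G\<^sub>2 S\<^sub>2 (C * n)"
    unfolding growth_le_def by blast
  have grp: "group G\<^sub>1" "group G\<^sub>2" using G1 G2 unfolding presents_def by blast+
  obtain D\<^sub>1 where D1: "D\<^sub>1 > 0" "\<And>n. word_ball G\<^sub>1 {x\<^sub>1, y\<^sub>1} n \<subseteq> word_ball G\<^sub>1 S\<^sub>1 (D\<^sub>1 * n)"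
    using group.word_ball_subset_scaled[OF grp(1) presents_generating[OF G1] S(1)] by blast
  obtain D\<^sub>2 where D2: "D\<^sub>2 > 0" "\<And>n. word_ball G\<^sub>2 S\<^sub>2 n \<subseteq> word_ball G\<^sub>2 {x\<^sub>2, y\<^sub>2} (D\<^sub>2 * n)"
    using group.word_ball_subset_scaled[OF grp(2) S(2) presents_generating[OF G2]] by blast
  have "infinite X" using inf(1) finite_Diff by blast
  then have LEF1: "LEF G\<^sub>1" using seq_LEF[OF G1] by blast
  \<comment> \<open>The constant is \<open>3 * 112\<close>, where \<open>112 = 8 * 7 * 2\<close>
    collects the factors in \<open>M\<close> and 3 comes from
    \<open>m_seq i \<le> 3 * k_seq i\<close>.\<close>
  obtain i where i: "i \<in> X" "i \<notin> Y" "336 * (D\<^sub>2 * C * D\<^sub>1) + 2 \<le> i"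
    using inf(1) by (meson DiffE infinite_nat_iff_unbounded_le)
  define n where "n = 7 * (D\<^sub>1 * (2 * m_seq i))"
  define M where "M = 8 * (D\<^sub>2 * (C * n)) + 2"
  have "M = 112 * (D\<^sub>2 * C * D\<^sub>1) * m_seq i + 2" by (simp add: M_def n_def)
  also have "\<dots> \<le> 112 * (D\<^sub>2 * C * D\<^sub>1) * (3 * k_seq i) + 2 * k_seq i"
    using m_le_triple_k_seq[of i] k_seq_pos[of i] by (intro add_mono mult_le_mono) auto
  also have "\<dots> = (336 * (D\<^sub>2 * C * D\<^sub>1) + 2) * k_seq i" by (simp add: algebra_simps)
  also have "\<dots> \<le> N_seq i * k_seq i" using i(3) le_N_seq[of i] by (intro mult_le_mono) linarith+
  finally have M: "M \<le> N_seq i * k_seq i" .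
  have "8 * (D\<^sub>2 * (C * n)) + 2 \<le> k_seq j" if "j \<in> Y" "i \<le> j" for j
  proof -
    \<comment> \<open>Since \<open>i\<close> is missing from \<open>Y\<close>, the first relevant
      fibre of the second group belongs to a strictly later scale.\<close>
    have "i < j" using that i(2) by (cases "i = j") auto
    then show ?thesis using k_seq_growth[of i j] M by (simp add: M_def)
  qed
  then obtain Q :: "nat monoid" and \<phi> where Q: "group Q" "finite (carrier Q)"
    "order Q \<le> fact (scale i) * (M * 2 ^ M)"
    "local_embedding G\<^sub>2 Q (word_ball G\<^sub>2 {x\<^sub>2, y\<^sub>2} (D\<^sub>2 * (C * n))) \<phi>"
    using seq_small_local_embedding[OF G2 _ inf(2)] unfolding M_def by blast
  have "LEF_growth G\<^sub>2 S\<^sub>2 (C * n) \<le> order Q"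
    using LEF_growth_le[OF Q(1,2)] local_embedding_mono[OF Q(4) D2(2)] by blast
  also have "order Q < fact (2 * q_seq i)"
    using Q(3) seq_gap[of M i] M by (simp add: k_seq_def power2_eq_square mult.assoc)
  also have "fact (2 * q_seq i) \<le> LEF_growth G\<^sub>1 S\<^sub>1 n"
  proof -
    obtain P :: "nat monoid" and \<psi> where P: "group P" "finite (carrier P)" "order P = LEF_growth G\<^sub>1 S\<^sub>1 n"
      "local_embedding G\<^sub>1 P (word_ball G\<^sub>1 S\<^sub>1 n) \<psi>"
      using LEF_growth_attained[OF grp(1) LEF1 S(1)] by blast
    then show ?thesis
      using seq_order_ge[OF G1 i(1) P(1,2) S(1) D1(2)] unfolding n_def by simp
  qed
  finally have "LEF_growth G\<^sub>2 S\<^sub>2 (C * n) < LEF_growth G\<^sub>1 S\<^sub>1 n" .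
  moreover have "n \<ge> 1"
    using D1(1) double_k_le_m_seq[of i] k_seq_pos[of i] by (simp add: n_def Suc_le_eq)
  ultimately show False using C(2)[of n] by simp
qed

text \<open>Distinct sets \<open>A\<close> yield index sets with infinite symmetric difference; every index set
  contains the infinite set of codes of pairs \<open>(0, b)\<close>.\<close>

definition index_set :: "nat set \<Rightarrow> nat set" where
  "index_set A = {i. fst (prod_decode i) \<in> insert 0 (Suc ` A)}"

lemma infinite_prod_encode: "infinite {prod_encode (a, b) |b. True}"
proof -
  have "inj (\<lambda>b. prod_encode (a, b))" by (auto intro: injI)
  then have "infinite (range (\<lambda>b. prod_encode (a, b)))" by (rule range_inj_infinite)
  moreover have "range (\<lambda>b. prod_encode (a, b)) = {prod_encode (a, b) |b. True}" by auto
  ultimately show ?thesis by simp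
qed

lemma infinite_index_set: "infinite (index_set A)"
  by (rule infinite_super[OF _ infinite_prod_encode[of 0]]) (auto simp: index_set_def)

lemma infinite_index_set_diff: "a \<in> A \<Longrightarrow> a \<notin> B \<Longrightarrow> infinite (index_set A - index_set B)"
  by (rule infinite_super[OF _ infinite_prod_encode[of "Suc a"]]) (auto simp: index_set_def)

lemma index_set_diff:
  "A \<noteq> B \<Longrightarrow> infinite (index_set A - index_set B) \<or> infinite (index_set B - index_set A)"
  using infinite_index_set_diff by blast

lemma growth_equiv_refl: "growth_equiv F F"
  unfolding growth_equiv_def growth_le_def by (auto intro: exI[of _ 1])

lemma uncountable_nat_sets: "uncountable (UNIV :: nat set set)"
  unfolding uncountable_def using Cantors_theorem[of "UNIV :: nat set"] by auto

theorem theorem1p6: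
  shows "\<exists>\<F> :: nat monoid set.
    uncountable \<F> \<and>
    (\<forall>\<Gamma>\<in>\<F>. group \<Gamma> \<and> finitely_generated \<Gamma> \<and> LEF \<Gamma>) \<and>
    (\<forall>\<Gamma>\<^sub>1\<in>\<F>. \<forall>\<Gamma>\<^sub>2\<in>\<F>. \<Gamma>\<^sub>1 \<noteq> \<Gamma>\<^sub>2 \<longrightarrow> \<not> \<Gamma>\<^sub>1 \<cong> \<Gamma>\<^sub>2) \<and>
    (\<forall>\<Gamma>\<^sub>1\<in>\<F>. \<forall>\<Gamma>\<^sub>2\<in>\<F>. \<Gamma>\<^sub>1 \<noteq> \<Gamma>\<^sub>2 \<longrightarrow>
      (\<forall>S\<^sub>1 S\<^sub>2. finite_generating_set \<Gamma>\<^sub>1 S\<^sub>1 \<and> finite_generating_set \<Gamma>\<^sub>2 S\<^sub>2 \<longrightarrow>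
        \<not> growth_equiv (LEF_growth \<Gamma>\<^sub>1 S\<^sub>1) (LEF_growth \<Gamma>\<^sub>2 S\<^sub>2)))"
proof -
  let ?P = "\<lambda>A (G :: nat monoid) x y. presents G x y (seq_shift (index_set A)) (seq_flip (index_set A))"
  have "\<exists>G x y. ?P A G x y" for A
    using flip_flow.exists_nat_presents[OF flip_flow_fib] .
  then obtain \<Gamma> X Y where \<Gamma>: "\<And>A. ?P A (\<Gamma> A) (X A) (Y A)" by metis
  have growth: "\<not> growth_equiv (LEF_growth G S) (LEF_growth H T)"
    if "?P A G x y" "?P B H u v" "A \<noteq> B" "finite_generating_set G S" "finite_generating_set H T"
    for A B G H x y u v S T
    using index_set_diff[OF that(3)] seq_not_growth_le[OF that(1,2) _ infinite_index_set that(4,5)]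
      seq_not_growth_le[OF that(2,1) _ infinite_index_set that(5,4)]
    unfolding growth_equiv_def by blast
  \<comment> \<open>The growth of one group for one generating set is equivalent to itself, so a
    group determines its set of naturals. This gives injectivity of the family and, after transport
    along isomorphisms, pairwise nonisomorphism.\<close>
  have same: "A = B" if "?P A G x y" "?P B G u v" for A B G x y u v
    using growth[OF that _ presents_generating[OF that(1)] presents_generating[OF that(1)]]
      growth_equiv_refl by blast
  show ?thesis
  proof (intro exI[of _ "range \<Gamma>"] conjI ballI impI allI)
    have "inj \<Gamma>"
    proof (rule injI)
      fix A B assume "\<Gamma> A = \<Gamma> B"
      then show "A = B" using same[OF \<Gamma>[of A]] \<Gamma>[of B] by metis
    qed
    then show "uncountable (range \<Gamma>)"
      using uncountable_nat_sets countable_image_inj_on by blast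
  next
    fix G assume "G \<in> range \<Gamma>"
    then obtain A where P: "?P A G (X A) (Y A)" using \<Gamma> by blast
    show "group G" using P unfolding presents_def by blast
    show "finitely_generated G"
      using presents_generating[OF P] unfolding finitely_generated_def by blast
    show "LEF G" using seq_LEF[OF P infinite_index_set] .
  next
    fix G H assume "G \<in> range \<Gamma>" "H \<in> range \<Gamma>" "G \<noteq> H"
    then obtain A B where A: "?P A G (X A) (Y A)" and B: "?P B H (X B) (Y B)" and "A \<noteq> B"
      using \<Gamma> by blast
    show "\<not> G \<cong> H"
    proof
      assume "G \<cong> H"
      then obtain f where f: "f \<in> iso G H" by (auto simp: is_iso_def)
      have "group H" using B unfolding presents_def by blast
      then have "?P A H (f (X A)) (f (Y A))" using presents_iso[OF A _ f] by blast
      then show False using same B \<open>A \<noteq> B\<close> by blast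
    qed
  next
    fix G H S T assume "G \<in> range \<Gamma>" "H \<in> range \<Gamma>" "G \<noteq> H"
      and ST: "finite_generating_set G S \<and> finite_generating_set H T"
    then obtain A B where "?P A G (X A) (Y A)" "?P B H (X B) (Y B)" "A \<noteq> B"
      using \<Gamma> by blast
    then show "\<not> growth_equiv (LEF_growth G S) (LEF_growth H T)" using growth ST by blast
  qed
qed

end
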